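(* (i) Let $\Lambda \subseteq \mathbb{C}$ be a set of interpolation for $\mathcal{F}^2$. For $\tau>0$ and $n \in \mathbb{N}$ large enough (so that the right-hand side is positive) let $\rho_n>0$ be defined by $\pi \rho_n^2 = n - \sqrt{n}\,(\sqrt{2\log n} + \tau)$, and let $B_{\rho_n} = \{z \in \mathbb{C} : |z| \le \rho_n\}$. Then for every $\tau>0$ large enough, the sets $\Lambda_n = \Lambda \cap B_{\rho_n}$ form a uniform interpolating family for $\mathcal{P}_n$ in $\mathcal{F}^2$. (ii) Conversely, if $(\Lambda_n)$ is a uniform interpolating family for $\mathcal{P}_n$ in $\mathcal{F}^2$, then every weak limit of $(\Lambda_n)$ is a set of interpolation for $\mathcal{F}^2$.
   Context: The Fock space $\mathcal{F}^2$ is the Hilbert space of all entire functions $f$ with finite norm $\|f\|_{\mathcal{F}^2} = \left(\int_{\mathbb{C}} |f(z)|^2 e^{-\pi |z|^2}\, dm(z)\right)^{1/2}$, where $dm$ is Lebesgue measure on $\mathbb{C} \simeq \mathbb{R}^2$. $\mathcal{P}_n$ denotes the space of holomorphic polynomials of degree at most $n$, with the inner product inherited from $\mathcal{F}^2$; its reproducing kernel is $k_n(z,w) = \sum_{k=0}^n \frac{(\pi z \bar w)^k}{k!}$. Set of interpolation: $\Lambda\subseteq\mathbb{C}$ is a set of interpolation for (interpolating in) $\mathcal{F}^2$ if for every $(a_\lambda)_{\lambda\in\Lambda}\in\ell^2(\Lambda)$ there exists $f\in\mathcal{F}^2$ such that $f(\lambda)e^{-\pi|\lambda|^2/2}=a_\lambda$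 for all $\lambda\in\Lambda$. Uniform interpolating family: a family of finite subsets $\Lambda_n\subseteq\mathbb{C}$ is a uniform interpolating family for $\mathcal{P}_n$ in $\mathcal{F}^2$ if there exist a constant $A>0$ and $n_0$ such that for all $n\ge n_0$ and every $a=(a_\lambda)_{\lambda\in\Lambda_n}\in\ell^2(\Lambda_n)$ there exists a polynomial $p\in\mathcal{P}_n$ such that $p(\lambda)k_n(\lambda,\lambda)^{-1/2}=a_\lambda$ for all $\lambda\in\Lambda_n$ and $\|p\|_{\mathcal{F}^2}^2\le A\|a\|_2^2$. Weak limit: a sequence of sets $\Lambda_n \subseteq \mathbb{C}$ converges weakly to $\Lambda \subseteq \mathbb{C}$ (and $\Lambda$ is a weak limit of $(\Lambda_n)$) if for all compact disks $B \subseteq \mathbb{C}$, $\lim_{n\to\infty} d\big((\Lambda_n\cap B)\cup \partial B, (\Lambda\cap B)\cup\partial B\big)=0$, where $d$ is the Hausdorff distance. *)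

theory Defs
  imports "HOL-Complex_Analysis.Complex_Analysis" "HOL-Computational_Algebra.Polynomial"
begin

definition fock_space :: "(complex \<Rightarrow> complex) set" where
  "fock_space = {f. f holomorphic_on UNIV \<and>
     integrable lborel (\<lambda>z::complex. (cmod (f z))\<^sup>2 * exp (- pi * (cmod z)\<^sup>2))}"

text \<open>The Fock norm; it is the intended quantity for members of \<^const>\<open>fock_space\<close>, which
  include all polynomials.\<close>

definition fock_norm :: "(complex \<Rightarrow> complex) \<Rightarrow> real" where
  "fock_norm f = sqrt (LINT z|lborel. (cmod (f z))\<^sup>2 * exp (- pi * (cmod z)\<^sup>2))"

definition poly_space :: "nat \<Rightarrow> complex poly set" where
  "poly_space n = {p. degree p \<le> n}"

definition poly_kernel :: "nat \<Rightarrow> complex \<Rightarrow> complex \<Rightarrow> complex" where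
  "poly_kernel n z w = (\<Sum>k\<le>n. (of_real pi * z * cnj w) ^ k / fact k)"

text \<open>Families indexed by \<open>\<Lambda>\<close> are functions on the whole plane, of which only
  the values on \<open>\<Lambda>\<close> matter.\<close>

definition fock_interpolating :: "complex set \<Rightarrow> bool" where
  "fock_interpolating \<Lambda> \<longleftrightarrow>
     (\<forall>a :: complex \<Rightarrow> complex. (\<lambda>l. (cmod (a l))\<^sup>2) summable_on \<Lambda> \<longrightarrow>
        (\<exists>f\<in>fock_space. \<forall>l\<in>\<Lambda>. f l * of_real (exp (- pi * (cmod l)\<^sup>2 / 2)) = a l))"

text \<open>The power below is applied to \<open>k\<^sub>n(\<lambda>,\<lambda>)\<close>, a real number that is at least 1,
  so the principal branch gives the usual real power.\<close>

definition uniform_interpolating_family :: "(nat \<Rightarrow> complex set) \<Rightarrow> bool" where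
  "uniform_interpolating_family L \<longleftrightarrow>
     (\<forall>n. finite (L n)) \<and>
     (\<exists>A::real. A > 0 \<and> (\<exists>n0. \<forall>n\<ge>n0. \<forall>a :: complex \<Rightarrow> complex.
        \<exists>p\<in>poly_space n.
          (\<forall>l\<in>L n. poly p l * poly_kernel n l l powr (- (1 / 2)) = a l) \<and>
          (fock_norm (poly p))\<^sup>2 \<le> A * (\<Sum>l\<in>L n. (cmod (a l))\<^sup>2)))"

text \<open>The suprema are those of real numbers, so this is the Hausdorff distance for
  nonempty bounded sets.\<close>

definition hausdorff_dist :: "'a::metric_space set \<Rightarrow> 'a set \<Rightarrow> real" where
  "hausdorff_dist X Y = max (SUP x\<in>X. infdist x Y) (SUP y\<in>Y. infdist y X)"

definition weak_limit :: "(nat \<Rightarrow> complex set) \<Rightarrow> complex set \<Rightarrow> bool" where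
  "weak_limit L \<Lambda> \<longleftrightarrow>
     (\<forall>c r. r > 0 \<longrightarrow>
        (\<lambda>n. hausdorff_dist ((L n \<inter> cball c r) \<union> frontier (cball c r))
                            ((\<Lambda> \<inter> cball c r) \<union> frontier (cball c r))) \<longlonglongrightarrow> 0)"

end

theory Submission
  imports Defs "HOL-Probability.Distributions" "HOL-Real_Asymp.Real_Asymp"
begin

text \<open>
  In the orthogonal basis of monomials the Fock norm is a weighted \<open>\<ell>\<^sup>2\<close> norm of the Taylor
  coefficients, so the remainder of the Taylor polynomial of degree \<open>n\<close> of \<open>f\<close> at \<open>z\<close> is at most
  \<open>\<parallel>f\<parallel>\<close> times the square root of the tail \<open>\<Sum>k>n. x\<^sup>k / k!\<close> with \<open>x = \<pi> \<bar>z\<bar>\<^sup>2\<close>. Chernoff's bound for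
  the Poisson distribution makes this tail at most \<open>e\<^sup>x exp (- \<tau>\<^sup>2 / 2) / n\<close> on the disc of radius
  \<open>\<rho>\<^sub>n\<close>.

  For (i), a gliding hump argument shows that interpolation on finite subsets of \<open>\<Lambda>\<close> is possible with
  a uniform constant, and hence that \<open>\<Lambda>\<close> is separated, so that \<open>\<Lambda>\<^sub>n\<close> has \<open>O(n)\<close> points. For
  large \<open>\<tau>\<close>, truncating the Taylor series of an interpolating function therefore gives a polynomial
  that interpolates up to an \<open>\<ell>\<^sup>2\<close> error of half the norm of the data, and iterating this removes the error.

  For (ii), points of the weak limit are limits of points of \<open>\<Lambda>\<^sub>n\<close>, so a normal family argument
  gives interpolation with a uniform constant on finite subsets of the weak limit. The weak limit
  therefore has no accumulation point in itself and is countable, and a second normal family argument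
  passes from finite subsets to the whole set.
\<close>

section \<open>The Gaussian measure on the complex plane\<close>

text \<open>The library has the invariance of Lebesgue measure under orthogonal maps only on
  \<^typ>\<open>real^'n\<close>, so rotations of the complex plane are transported to \<^typ>\<open>real^2\<close>.\<close>

lemma lborel_complex_eq_distr_vec:
  "(lborel :: complex measure) = distr lborel borel (\<lambda>v::real^2. Complex (vec_nth v 1) (vec_nth v 2))"
proof (rule lborel_eqI)
  let ?\<phi> = "\<lambda>v::real^2. Complex (vec_nth v 1) (vec_nth v 2)"
  have [measurable]: "?\<phi> \<in> borel_measurable borel"
    by (intro borel_measurable_continuous_onI continuous_intros)
  have B: "(Basis :: (real^2) set) = {axis 1 1, axis 2 1}"
    by (auto simp: Basis_vec_def UNIV_2)
  fix l u :: complex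
  assume le': "\<And>b. b \<in> Basis \<Longrightarrow> l \<bullet> b \<le> u \<bullet> b"
  have le: "Re l \<le> Re u" "Im l \<le> Im u"
    using le'[of 1] le'[of \<i>] by (auto simp: Basis_complex_def)
  let ?l = "vector [Re l, Im l] :: real^2" and ?u = "vector [Re u, Im u] :: real^2"
  have vim: "?\<phi> -` box l u = box ?l ?u"
    by (auto simp: box_def B Basis_complex_def inner_axis)
  have "emeasure (distr lborel borel ?\<phi>) (box l u) = emeasure lborel (box ?l ?u)"
    using vim by (subst emeasure_distr) auto
  also have "\<dots> = (\<Prod>b\<in>Basis. (?u - ?l) \<bullet> b)"
    using le by (intro emeasure_lborel_box) (auto simp: B Basis_complex_def inner_axis)
  also have "\<dots> = (\<Prod>b\<in>Basis. (u - l) \<bullet> b)"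
    by (auto simp: B Basis_complex_def inner_axis axis_eq_axis complex_eq_iff)
  finally show "emeasure (distr lborel borel ?\<phi>) (box l u) = (\<Prod>b\<in>Basis. (u - l) \<bullet> b)" .
qed auto

text \<open>This symmetry is what later annihilates the mixed moments. Seen in
  \<open>real^2\<close>, the preimage of a box under multiplication by \<open>w\<close> is the image
  of a box under the inverse rotation, which is orthogonal and so preserves its measure.\<close>

lemma lborel_distr_unit_mult:
  assumes w: "cmod w = 1"
  shows "distr lborel borel ((*) w) = (lborel :: complex measure)"
proof (rule sym, rule lborel_eqI)
  fix l u :: complex
  assume le': "\<And>b. b \<in> Basis \<Longrightarrow> l \<bullet> b \<le> u \<bullet> b"
  have le: "Re l \<le> Re u" "Im l \<le> Im u"
    using le'[of 1] le'[of \<i>] by (auto simp: Basis_complex_def)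
  let ?\<phi> = "\<lambda>v::real^2. Complex (vec_nth v 1) (vec_nth v 2)"
  let ?l = "vector [Re l, Im l] :: real^2" and ?u = "vector [Re u, Im u] :: real^2"
  have [measurable]: "?\<phi> \<in> borel_measurable borel"
    by (intro borel_measurable_continuous_onI continuous_intros)
  have B: "(Basis :: (real^2) set) = {axis 1 1, axis 2 1}"
    by (auto simp: Basis_vec_def UNIV_2)
  \<comment> \<open>\<open>T\<close> and \<open>T'\<close> are multiplication by
    \<open>cnj w\<close> and by \<open>w\<close> in coordinates. They are inverse to each other,
    which turns a preimage under \<open>T'\<close> into an image under \<open>T\<close>.\<close>
  define T where "T = (\<lambda>v. vector [Re (cnj w * ?\<phi> v), Im (cnj w * ?\<phi> v)] :: real^2)"
  define T' where "T' = (\<lambda>v. vector [Re (w * ?\<phi> v), Im (w * ?\<phi> v)] :: real^2)"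
  have w1: "w * cnj w = 1"
    using w by (simp add: complex_mult_cnj cmod_def)
  have \<phi>T: "?\<phi> (T v) = cnj w * ?\<phi> v" "?\<phi> (T' v) = w * ?\<phi> v" for v
    by (simp_all add: T_def T'_def complex_eq_iff)
  have \<phi>_inj: "?\<phi> v = ?\<phi> v' \<longleftrightarrow> v = v'" for v v'
    by (simp add: vec_eq_iff forall_2)
  have TT': "T (T' v) = v" "T' (T v) = v" for v
  proof -
    have "?\<phi> (T (T' v)) = ?\<phi> v" "?\<phi> (T' (T v)) = ?\<phi> v"
      unfolding \<phi>T using w1 by (simp_all add: mult.assoc[symmetric] mult.commute[of "cnj w" w])
    then show "T (T' v) = v" "T' (T v) = v"
      unfolding \<phi>_inj .
  qed
  have "linear T"
    by (rule linearI) (auto simp: T_def vec_eq_iff forall_2 algebra_simps)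
  moreover have "norm (T v) = norm v" for v
  proof -
    have nrm: "norm v = cmod (?\<phi> v)" for v
      by (simp add: norm_vec_def L2_set_def UNIV_2 cmod_def)
    show ?thesis
      unfolding nrm[of v] nrm[of "T v"] \<phi>T using w by (simp add: norm_mult)
  qed
  ultimately have orth: "orthogonal_transformation T"
    by (simp add: orthogonal_transformation)
  have vim: "?\<phi> -` box l u = box ?l ?u"
    by (auto simp: box_def B Basis_complex_def inner_axis)
  have vim': "?\<phi> -` ((*) w -` box l u) = T ` box ?l ?u" (is "?A = _")
  proof -
    have "?A = T' -` (?\<phi> -` box l u)"
      by (auto simp: \<phi>T)
    also have "\<dots> = T ` box ?l ?u"
      unfolding vim
    proof (intro set_eqI iffI)
      fix v assume "v \<in> T' -` box ?l ?u"
      then show "v \<in> T ` box ?l ?u"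
        by (intro image_eqI[of v T "T' v"]) (simp_all add: TT')
    next
      fix v assume "v \<in> T ` box ?l ?u"
      then show "v \<in> T' -` box ?l ?u"
        by (elim imageE) (simp add: TT')
    qed
    finally show ?thesis .
  qed
  have [measurable]: "(*) w \<in> borel_measurable borel"
    by simp
  have wb: "(*) w -` box l u \<in> sets borel"
    by (intro borel_open open_vimage open_box continuous_intros)
  have Ab: "?A \<in> sets borel"
    by (rule measurable_sets_borel[OF _ wb]) auto
  have lm: "box ?l ?u \<in> lmeasurable"
    by simp
  have "emeasure (distr lborel borel ((*) w)) (box l u) = emeasure (lborel::complex measure) ((*) w -` box l u)"
    by (subst emeasure_distr) auto
  also have "\<dots> = emeasure (distr lborel borel ?\<phi>) ((*) w -` box l u)"
    using lborel_complex_eq_distr_vec by simp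
  also have "\<dots> = emeasure lborel ?A"
    by (subst emeasure_distr) (auto simp: wb)
  also have "\<dots> = emeasure lebesgue (T ` box ?l ?u)"
    using Ab unfolding vim'[symmetric] by simp
  also have "\<dots> = measure lebesgue (T ` box ?l ?u)"
    using measurable_orthogonal_image[OF orth lm] by (rule emeasure_eq_measure2)
  also have "\<dots> = measure lebesgue (box ?l ?u)"
    by (simp add: measure_orthogonal_image[OF orth lm])
  also have "\<dots> = emeasure lebesgue (box ?l ?u)"
    using lm by (rule emeasure_eq_measure2[symmetric])
  also have "\<dots> = (\<Prod>b\<in>Basis. (?u - ?l) \<bullet> b)"
  proof -
    have "emeasure lebesgue (box ?l ?u) = emeasure lborel (box ?l ?u)"
      by simp
    also have "\<dots> = (\<Prod>b\<in>Basis. (?u - ?l) \<bullet> b)"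
      using le by (intro emeasure_lborel_box) (auto simp: B Basis_complex_def inner_axis)
    finally show ?thesis .
  qed
  also have "\<dots> = (\<Prod>b\<in>Basis. (u - l) \<bullet> b)"
    by (auto simp: B Basis_complex_def inner_axis axis_eq_axis complex_eq_iff)
  finally show "emeasure (distr lborel borel ((*) w)) (box l u) = (\<Prod>b\<in>Basis. (u - l) \<bullet> b)" .
qed auto

text \<open>A disc of radius \<open>sqrt t\<close> has area \<open>pi * t\<close>, so the squared
  modulus is distributed as \<open>pi\<close> times Lebesgue measure on a half-line. The minus sign
  makes the rays \<open>{x<..}\<close>, on which the measures are compared, have finite
  measure.\<close>

lemma distr_neg_cmod_square:
  "distr lborel borel (\<lambda>z::complex. - (cmod z)\<^sup>2) = density lborel (\<lambda>x. ennreal pi * indicator {..0} x)"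
proof (rule measure_eqI_lessThan)
  fix x :: real
  have "emeasure (distr lborel borel (\<lambda>z::complex. - (cmod z)\<^sup>2)) {x<..} = emeasure lborel (ball 0 (sqrt (-x)) :: complex set)"
  proof -
    have "(\<lambda>z::complex. - (cmod z)\<^sup>2) -` {x<..} = ball 0 (sqrt (-x))"
    proof (intro set_eqI iffI)
      fix z :: complex assume "z \<in> (\<lambda>z. - (cmod z)\<^sup>2) -` {x<..}"
      then show "z \<in> ball 0 (sqrt (-x))"
        by (auto intro!: real_less_rsqrt)
    next
      fix z :: complex assume "z \<in> ball 0 (sqrt (-x))"
      then have z: "cmod z < sqrt (-x)" by simp
      then have "sqrt (-x) > 0" using norm_ge_zero[of z] by linarith
      then have "x < 0" by simp
      then show "z \<in> (\<lambda>z. - (cmod z)\<^sup>2) -` {x<..}"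
        using power_strict_mono[OF z, of 2] by simp
    qed
    then show ?thesis by (subst emeasure_distr) auto
  qed
  also have "\<dots> = ennreal (pi * max 0 (-x))"
  proof (cases "x \<le> 0")
    case True
    then show ?thesis
      by (subst emeasure_ball) (auto simp: unit_ball_vol_2)
  qed (auto simp: max_def ball_empty)
  finally have 1: "emeasure (distr lborel borel (\<lambda>z::complex. - (cmod z)\<^sup>2)) {x<..} = ennreal (pi * max 0 (-x))" .
  then show "emeasure (distr lborel borel (\<lambda>z::complex. - (cmod z)\<^sup>2)) {x<..} < \<infinity>"
    by simp
  have "emeasure (density lborel (\<lambda>x. ennreal pi * indicator {..0} x)) {x<..}
      = (\<integral>\<^sup>+t. ennreal pi * indicator {x<..0} t \<partial>lborel)"
    by (subst emeasure_density) (auto intro!: nn_integral_cong split: split_indicator)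
  also have "\<dots> = ennreal pi * emeasure lborel {x<..0}"
    by (subst nn_integral_cmult_indicator) auto
  also have "\<dots> = ennreal (pi * max 0 (-x))"
    by (cases "x \<le> 0") (auto simp: ennreal_mult[symmetric] max_def)
  finally show "emeasure (distr lborel borel (\<lambda>z::complex. - (cmod z)\<^sup>2)) {x<..} =
    emeasure (density lborel (\<lambda>x. ennreal pi * indicator {..0} x)) {x<..}"
    using 1 by simp
qed auto

lemma nn_integral_gaussian_moment:
  "(\<integral>\<^sup>+z. ennreal ((cmod z) ^ (2 * k) * exp (- pi * (cmod z)\<^sup>2)) \<partial>lborel) = ennreal (fact k / pi ^ k)"
proof -
  let ?g = "\<lambda>x::real. ennreal ((-x) ^ k * exp (pi * x))"
  have "(\<integral>\<^sup>+z. ennreal ((cmod z) ^ (2 * k) * exp (- pi * (cmod z)\<^sup>2)) \<partial>lborel)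
     = (\<integral>\<^sup>+x. ?g x \<partial>distr lborel borel (\<lambda>z::complex. - (cmod z)\<^sup>2))"
    by (subst nn_integral_distr) (auto simp: power_mult)
  also have "\<dots> = (\<integral>\<^sup>+x. ennreal pi * indicator {..0} x * ?g x \<partial>lborel)"
    unfolding distr_neg_cmod_square by (subst nn_integral_density) auto
  \<comment> \<open>The substitution \<open>x = - y / pi\<close> undoes the sign and the factor
    \<open>pi\<close>, leaving the Gamma integral of \<open>y ^ k * exp (- y)\<close>.\<close>
  also have "\<dots> = ennreal \<bar>- 1 / pi\<bar> * (\<integral>\<^sup>+y. ennreal pi * indicator {..0} (0 + (-1/pi) * y) * ?g (0 + (-1/pi) * y) \<partial>lborel)"
    by (rule nn_integral_real_affine) auto
  also have "\<dots> = ennreal (1/pi) * (\<integral>\<^sup>+y. ennreal (pi / pi ^ k) * (ennreal (y ^ k * exp (- y)) * indicator {0..} y) \<partial>lborel)"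
  proof -
    have "ennreal pi * indicator {..0} (0 + (-1/pi) * y) * ?g (0 + (-1/pi) * y)
        = ennreal (pi / pi ^ k) * (ennreal (y ^ k * exp (- y)) * indicator {0..} y)" for y
    proof (cases "y \<ge> 0")
      case True
      then have "indicator {..0} (0 + (-1/pi) * y) = (1::ennreal)"
        by (auto simp: indicator_def)
      then show ?thesis using True
        by (simp add: ennreal_mult[symmetric] power_divide field_simps)
    next
      case False
      then have "indicator {..0} (0 + (-1/pi) * y) = (0::ennreal)"
        by (auto simp: indicator_def divide_less_0_iff not_le)
      then show ?thesis using False by simp
    qed
    then show ?thesis by (simp only: ) simp
  qed
  also have "\<dots> = ennreal (1/pi) * (ennreal (pi / pi ^ k) * ennreal (fact k))"
    using nn_intergal_power_times_exp_Ici[of k] by (subst nn_integral_cmult) auto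
  also have "\<dots> = ennreal (fact k / pi ^ k)"
    by (simp add: ennreal_mult[symmetric])
  finally show ?thesis .
qed

section \<open>Taylor coefficients of functions in the Fock space\<close>

lemma integrable_gaussian_moment:
  "integrable lborel (\<lambda>z. (cmod z) ^ (2 * k) * exp (- pi * (cmod z)\<^sup>2))"
  by (rule integrableI_nonneg) (auto simp: nn_integral_gaussian_moment[simplified])

lemma integral_gaussian_moment:
  "(LINT z|lborel. (cmod z) ^ (2 * k) * exp (- pi * (cmod z)\<^sup>2)) = fact k / pi ^ k"
  by (subst integral_eq_nn_integral) (auto simp: nn_integral_gaussian_moment[simplified])

section \<open>Orthogonality of the monomials for radial weights\<close>

text \<open>Two weights are needed: the Gaussian on the whole plane, and its restriction to a disc,
  where Taylor series converge uniformly. The comparison with the Gaussian makes all moments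
  finite.\<close>

locale radial_weight =
  fixes w :: "complex \<Rightarrow> real"
  assumes measurable [measurable]: "w \<in> borel_measurable borel"
    and radial: "cmod c = 1 \<Longrightarrow> w (c * z) = w z"
    and nonneg: "0 \<le> w z"
    and le_gaussian: "w z \<le> exp (- pi * (cmod z)\<^sup>2)"
begin

lemma cnj_measurable [measurable]: "cnj \<in> borel_measurable borel"
  by (intro borel_measurable_continuous_onI continuous_intros)

lemma integrable_monomials: "integrable lborel (\<lambda>z. z ^ k * cnj z ^ l * of_real (w z))"
proof (rule Bochner_Integration.integrable_bound)
  show "integrable lborel (\<lambda>z. (cmod z) ^ (2 * k) * exp (- pi * (cmod z)\<^sup>2) +
      (cmod z) ^ (2 * l) * exp (- pi * (cmod z)\<^sup>2))"
    by (intro Bochner_Integration.integrable_add integrable_gaussian_moment)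
  have "(cmod z) ^ k * (cmod z) ^ l * w z
      \<le> ((cmod z) ^ (2 * k) + (cmod z) ^ (2 * l)) * exp (- pi * (cmod z)\<^sup>2)" for z
  proof (rule mult_mono)
    have "0 \<le> ((cmod z) ^ k - (cmod z) ^ l)\<^sup>2 + ((cmod z) ^ k)\<^sup>2 + ((cmod z) ^ l)\<^sup>2"
      by simp
    then show "(cmod z) ^ k * (cmod z) ^ l \<le> (cmod z) ^ (2 * k) + (cmod z) ^ (2 * l)"
      by (simp add: power2_diff power_mult mult.commute[of 2])
  qed (use le_gaussian[of z] in \<open>auto simp: nonneg\<close>)
  then show "AE z in lborel. cmod (z ^ k * cnj z ^ l * of_real (w z)) \<le>
      norm ((cmod z) ^ (2 * k) * exp (- pi * (cmod z)\<^sup>2) + (cmod z) ^ (2 * l) * exp (- pi * (cmod z)\<^sup>2))"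
    by (intro AE_I2) (auto simp: norm_mult norm_power nonneg distrib_right intro: order.trans)
qed simp

text \<open>Rotation by the angle \<open>pi / (k - l)\<close> preserves both the measure and the
  weight but multiplies the integrand by -1, so the integral equals its own negative.\<close>

lemma integral_monomials_eq_0:
  assumes "k \<noteq> l"
  shows "(LINT z|lborel. z ^ k * cnj z ^ l * of_real (w z)) = 0"
proof -
  let ?f = "\<lambda>z. z ^ k * cnj z ^ l * complex_of_real (w z)"
  define t where "t = pi / (real k - real l)"
  define c where "c = cis t"
  have ckl: "c ^ k * cnj c ^ l = -1"
  proof -
    have "c ^ k * cnj c ^ l = cis (real k * t - real l * t)"
      by (simp only: c_def Complex.DeMoivre cis_cnj cis_mult) simp
    also have "real k * t - real l * t = pi"
      using assms by (simp add: t_def diff_divide_distrib[symmetric] left_diff_distrib[symmetric])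
    finally show ?thesis by simp
  qed
  have cc: "cmod c = 1"
    by (simp add: c_def)
  have "(LINT z|lborel. ?f z) = (LINT z|distr lborel borel ((*) c). ?f z)"
    by (simp add: lborel_distr_unit_mult[OF cc])
  also have "\<dots> = (LINT z|lborel. ?f (c * z))"
    by (rule integral_distr) auto
  also have "\<dots> = (LINT z|lborel. (c ^ k * cnj c ^ l) * ?f z)"
    by (simp only: radial[OF cc] complex_cnj_mult power_mult_distrib) (simp add: mult_ac)
  also have "\<dots> = - (LINT z|lborel. ?f z)"
    unfolding ckl by simp
  finally show ?thesis
    by simp
qed

text \<open>Parseval's identity: the square expands into a double sum of mixed moments, of which
  only the diagonal survives.\<close>

lemma integral_square_polynomial:
  fixes c :: "nat \<Rightarrow> complex"
  shows "integrable lborel (\<lambda>z. (cmod (\<Sum>k<n. c k * z ^ k))\<^sup>2 * w z)" (is ?A)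
    and "(LINT z|lborel. (cmod (\<Sum>k<n. c k * z ^ k))\<^sup>2 * w z) =
      (\<Sum>k<n. (cmod (c k))\<^sup>2 * (LINT z|lborel. (cmod z) ^ (2 * k) * w z))" (is ?B)
proof -
  let ?P = "\<lambda>z. \<Sum>k<n. c k * z ^ k"
  have eq: "complex_of_real ((cmod (?P z))\<^sup>2 * w z) =
      (\<Sum>k<n. \<Sum>l<n. (c k * cnj (c l)) * (z ^ k * cnj z ^ l * of_real (w z)))" for z
  proof -
    have "complex_of_real ((cmod (?P z))\<^sup>2 * w z) = ?P z * cnj (?P z) * of_real (w z)"
      by (simp only: of_real_mult complex_norm_square)
    also have "\<dots> = (\<Sum>k<n. \<Sum>l<n. (c k * cnj (c l)) * (z ^ k * cnj z ^ l * of_real (w z)))"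
      by (subst cnj_sum, subst sum_product) (simp add: sum_distrib_right sum_distrib_left mult_ac)
    finally show ?thesis .
  qed
  have int: "integrable lborel (\<lambda>z. complex_of_real ((cmod (?P z))\<^sup>2 * w z))"
    unfolding eq by (intro Bochner_Integration.integrable_sum integrable_mult_right integrable_monomials)
  then show ?A
    by (subst (asm) complex_of_real_integrable_eq)
  have diag: "(LINT z|lborel. z ^ k * cnj z ^ k * of_real (w z)) = of_real (LINT z|lborel. (cmod z) ^ (2 * k) * w z)" for k
  proof -
    have "z ^ k * cnj z ^ k * of_real (w z) = complex_of_real ((cmod z) ^ (2 * k) * w z)" for z
      by (simp add: power_mult power_mult_distrib[symmetric] complex_norm_square[symmetric])
    then show ?thesis
      by (simp only: integral_complex_of_real)
  qed
  have "complex_of_real (LINT z|lborel. (cmod (?P z))\<^sup>2 * w z) = (LINT z|lborel. complex_of_real ((cmod (?P z))\<^sup>2 * w z))"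
    by (rule integral_complex_of_real[symmetric])
  also have "\<dots> = (\<Sum>k<n. \<Sum>l<n. (c k * cnj (c l)) * (LINT z|lborel. z ^ k * cnj z ^ l * of_real (w z)))"
    unfolding eq
    by (subst Bochner_Integration.integral_sum,
        intro Bochner_Integration.integrable_sum integrable_mult_right integrable_monomials,
        intro sum.cong refl, subst Bochner_Integration.integral_sum,
        intro integrable_mult_right integrable_monomials, simp)
  also have "\<dots> = (\<Sum>k<n. \<Sum>l<n. if k = l then of_real ((cmod (c k))\<^sup>2 * (LINT z|lborel. (cmod z) ^ (2 * k) * w z)) else 0)"
    by (intro sum.cong refl) (auto simp: integral_monomials_eq_0 diag complex_norm_square[unfolded of_real_power])
  also have "\<dots> = of_real (\<Sum>k<n. (cmod (c k))\<^sup>2 * (LINT z|lborel. (cmod z) ^ (2 * k) * w z))"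
    by (simp add: sum.delta')
  finally show ?B
    by (simp only: of_real_eq_iff)
qed

end

lemma gaussian_radial_weight: "radial_weight (\<lambda>z. exp (- pi * (cmod z)\<^sup>2))"
  by unfold_locales (auto simp: norm_mult)

lemma truncated_gaussian_radial_weight:
  "radial_weight (\<lambda>z. exp (- pi * (cmod z)\<^sup>2) * indicator (cball 0 R) z)"
  by unfold_locales (auto simp: norm_mult indicator_def)

lemma fock_norm_square: "(fock_norm f)\<^sup>2 = (LINT z|lborel. (cmod (f z))\<^sup>2 * exp (- pi * (cmod z)\<^sup>2))"
  by (simp add: fock_norm_def)

lemma fock_norm_polynomial:
  fixes c :: "nat \<Rightarrow> complex"
  shows "(fock_norm (\<lambda>z. \<Sum>k<n. c k * z ^ k))\<^sup>2 = (\<Sum>k<n. (cmod (c k))\<^sup>2 * (fact k / pi ^ k))"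
proof -
  interpret radial_weight "\<lambda>z. exp (- pi * (cmod z)\<^sup>2)"
    by (rule gaussian_radial_weight)
  show ?thesis
    by (simp only: fock_norm_square integral_square_polynomial(2) integral_gaussian_moment)
qed

lemma polynomial_in_fock_space: "(\<lambda>z. \<Sum>k<n. c k * z ^ k) \<in> fock_space"
proof -
  interpret radial_weight "\<lambda>z. exp (- pi * (cmod z)\<^sup>2)"
    by (rule gaussian_radial_weight)
  show ?thesis
    unfolding fock_space_def using integral_square_polynomial(1)[of c n]
    by (auto intro!: holomorphic_intros)
qed

lemma fock_norm_nonneg: "0 \<le> fock_norm f"
  by (simp add: fock_norm_def)

lemma truncated_moment_tendsto:
  "(\<lambda>j. LINT z|lborel. (cmod z) ^ (2 * k) * (exp (- pi * (cmod z)\<^sup>2) * indicator (cball 0 (real j)) z))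
     \<longlonglongrightarrow> fact k / pi ^ k"
  unfolding integral_gaussian_moment[symmetric]
proof (rule integral_dominated_convergence)
  show "integrable lborel (\<lambda>z. (cmod z) ^ (2 * k) * exp (- pi * (cmod z)\<^sup>2))"
    by (rule integrable_gaussian_moment)
  show "AE z in lborel. (\<lambda>j. (cmod z) ^ (2 * k) * (exp (- pi * (cmod z)\<^sup>2) * indicator (cball 0 (real j)) z))
      \<longlonglongrightarrow> (cmod z) ^ (2 * k) * exp (- pi * (cmod z)\<^sup>2)"
  proof (intro AE_I2 tendsto_eventually)
    fix z :: complex
    obtain N :: nat where "cmod z \<le> real N"
      using real_arch_simple by blast
    then show "\<forall>\<^sub>F j in sequentially. (cmod z) ^ (2 * k) * (exp (- pi * (cmod z)\<^sup>2) * indicator (cball 0 (real j)) z)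
      = (cmod z) ^ (2 * k) * exp (- pi * (cmod z)\<^sup>2)"
      by (intro eventually_sequentiallyI[of N]) (auto simp: indicator_def)
  qed
  show "(\<lambda>z. (cmod z) ^ (2 * k) * (exp (- pi * (cmod z)\<^sup>2) * indicator (cball 0 (real j)) z)) \<in> borel_measurable lborel" for j
    using radial_weight.measurable[OF truncated_gaussian_radial_weight] by simp
qed (auto split: split_indicator)

text \<open>An inequality is all that is used later, so no density of polynomials is required. On
  each disc the integral of \<open>f\<close> dominates the sum weighted by truncated moments; as the
  discs exhaust the plane, these moments tend to \<open>fact k / pi ^ k\<close>.\<close>

lemma fock_bessel:
  assumes f: "f \<in> fock_space" and c: "\<And>z. (\<lambda>k. c k * z ^ k) sums f z"
  shows "(\<Sum>k<n. (cmod (c k))\<^sup>2 * (fact k / pi ^ k)) \<le> (fock_norm f)\<^sup>2"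
proof (rule LIMSEQ_le_const2)
  let ?w = "\<lambda>R z. exp (- pi * (cmod z)\<^sup>2) * indicator (cball 0 R) z :: real"
  show "(\<lambda>j. \<Sum>k<n. (cmod (c k))\<^sup>2 * (LINT z|lborel. (cmod z) ^ (2 * k) * ?w (real j) z))
      \<longlonglongrightarrow> (\<Sum>k<n. (cmod (c k))\<^sup>2 * (fact k / pi ^ k))"
    by (intro tendsto_intros truncated_moment_tendsto)
  \<comment> \<open>On a disc the Taylor polynomials converge boundedly, so orthogonality passes to the limit.\<close>
  have "(\<Sum>k<n. (cmod (c k))\<^sup>2 * (LINT z|lborel. (cmod z) ^ (2 * k) * ?w R z)) \<le> (fock_norm f)\<^sup>2" if "R \<ge> 0" for R
  proof -
    interpret radial_weight "?w R"
      by (rule truncated_gaussian_radial_weight)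
    have fm[measurable]: "f \<in> borel_measurable borel"
      using f by (auto simp: fock_space_def intro!: borel_measurable_continuous_onI holomorphic_on_imp_continuous_on)
    have fi: "integrable lborel (\<lambda>z. (cmod (f z))\<^sup>2 * exp (- pi * (cmod z)\<^sup>2))"
      using f by (simp add: fock_space_def)
    let ?P = "\<lambda>N z. \<Sum>k<N. c k * z ^ k"
    have sm: "summable (\<lambda>k. cmod (c k) * R ^ k)"
    proof -
      \<comment> \<open>Convergence at the larger radius \<open>R + 1\<close> yields absolute
        convergence at \<open>R\<close>, hence a bound on all partial sums over the closed
        disc.\<close>
      have "summable (\<lambda>k. norm (c k * of_real R ^ k))"
        by (rule powser_insidea[of _ "of_real (R + 1)"])
          (use that c[of "of_real (R+1)"] in \<open>auto simp: sums_iff simp del: of_real_add\<close>)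
      then show ?thesis using that by (simp add: norm_mult norm_power)
    qed
    define S where "S = (\<Sum>k. cmod (c k) * R ^ k)"
    have PS: "cmod (?P N z) \<le> S" if z: "z \<in> cball 0 R" for N z
    proof -
      have "cmod (?P N z) \<le> (\<Sum>k<N. cmod (c k) * R ^ k)"
        using z by (intro order.trans[OF norm_sum] sum_mono) (auto simp: norm_mult norm_power intro!: mult_left_mono power_mono)
      also have "\<dots> \<le> S"
        unfolding S_def using that \<open>R \<ge> 0\<close> by (intro sum_le_suminf sm) auto
      finally show ?thesis .
    qed
    have lim: "(\<lambda>N. LINT z|lborel. (cmod (?P N z))\<^sup>2 * ?w R z) \<longlonglongrightarrow> (LINT z|lborel. (cmod (f z))\<^sup>2 * ?w R z)"
    proof (rule integral_dominated_convergence)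
      show "integrable lborel (\<lambda>z. S\<^sup>2 * indicator (cball (0::complex) R) z)"
        by (intro integrable_mult_right) (auto simp: emeasure_cball that intro!: integrable_real_indicator)
      show "AE z in lborel. (\<lambda>N. (cmod (?P N z))\<^sup>2 * ?w R z) \<longlonglongrightarrow> (cmod (f z))\<^sup>2 * ?w R z"
        using c unfolding sums_def by (intro AE_I2 tendsto_intros) auto
      show "AE z in lborel. norm ((cmod (?P N z))\<^sup>2 * ?w R z) \<le> S\<^sup>2 * indicator (cball 0 R) z" for N
      proof (intro AE_I2)
        fix z
        show "norm ((cmod (?P N z))\<^sup>2 * ?w R z) \<le> S\<^sup>2 * indicator (cball 0 R) z"
          using PS[of z N] by (auto simp: indicator_def power_mono intro!: mult_mono[of _ "S\<^sup>2" _ 1, simplified])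
      qed
      show "(\<lambda>z. (cmod (f z))\<^sup>2 * ?w R z) \<in> borel_measurable lborel"
        "(\<lambda>z. (cmod (?P N z))\<^sup>2 * ?w R z) \<in> borel_measurable lborel" for N
        by measurable
    qed
    have "(\<Sum>k<n. (cmod (c k))\<^sup>2 * (LINT z|lborel. (cmod z) ^ (2 * k) * ?w R z))
        \<le> (LINT z|lborel. (cmod (f z))\<^sup>2 * ?w R z)"
    proof (rule LIMSEQ_le_const[OF lim], intro exI[of _ n] allI impI)
      fix N assume "n \<le> N"
      then have "(\<Sum>k<n. (cmod (c k))\<^sup>2 * (LINT z|lborel. (cmod z) ^ (2 * k) * ?w R z))
          \<le> (\<Sum>k<N. (cmod (c k))\<^sup>2 * (LINT z|lborel. (cmod z) ^ (2 * k) * ?w R z))"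
        by (intro sum_mono2) (auto intro!: mult_nonneg_nonneg integral_nonneg)
      then show "(\<Sum>k<n. (cmod (c k))\<^sup>2 * (LINT z|lborel. (cmod z) ^ (2 * k) * ?w R z))
          \<le> (LINT z|lborel. (cmod (?P N z))\<^sup>2 * ?w R z)"
        by (simp only: integral_square_polynomial)
    qed
    also have "\<dots> \<le> (fock_norm f)\<^sup>2"
      unfolding fock_norm_square
    proof (rule integral_mono)
      show "integrable lborel (\<lambda>z. (cmod (f z))\<^sup>2 * ?w R z)"
      proof (rule Bochner_Integration.integrable_bound[OF fi])
        show "(\<lambda>z. (cmod (f z))\<^sup>2 * ?w R z) \<in> borel_measurable lborel"
          by measurable
      qed (auto split: split_indicator)
    qed (use fi in \<open>auto split: split_indicator\<close>)
    finally show ?thesis .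
  qed
  then show "\<exists>N. \<forall>j\<ge>N. (\<Sum>k<n. (cmod (c k))\<^sup>2 * (LINT z|lborel. (cmod z) ^ (2 * k) * ?w (real j) z)) \<le> (fock_norm f)\<^sup>2"
    by auto
qed

section \<open>Taylor remainders and pointwise bounds\<close>

text \<open>For \<open>x >= 0\<close> this is \<open>exp x\<close> times the probability that a
  Poisson variable of mean \<open>x\<close> is at least \<open>n\<close>. The term of index
  \<open>n\<close> is included, so the remainder after degree \<open>n\<close> is governed by
  \<open>exp_tail (Suc n)\<close>.\<close>

definition exp_tail :: "nat \<Rightarrow> real \<Rightarrow> real" where
  "exp_tail n x = exp x - (\<Sum>k<n. x ^ k / fact k)"

lemma exp_partial_sum_le: "0 \<le> x \<Longrightarrow> (\<Sum>k<n. x ^ k / fact k) \<le> exp (x::real)"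
  using exp_converges[of x] by (intro sum_le_suminf[THEN order.trans]) (auto simp: sums_iff divide_inverse mult.commute)

lemma exp_tail_nonneg: "0 \<le> x \<Longrightarrow> 0 \<le> exp_tail n x"
  by (simp add: exp_tail_def exp_partial_sum_le)

lemma entire_power_series:
  assumes "f holomorphic_on UNIV"
  obtains c where "\<And>z. (\<lambda>k. c k * z ^ k) sums f z"
proof
  fix z
  show "(\<lambda>k. (deriv ^^ k) f 0 / fact k * z ^ k) sums f z"
    using holomorphic_power_series[of f 0 "cmod z + 1" z] holomorphic_on_subset[OF assms]
    by auto
qed

text \<open>Cauchy-Schwarz with the weights \<open>sqrt (fact k / pi ^ k)\<close> and their
  reciprocals: Bessel's inequality controls the coefficients, and what remains of the powers of
  \<open>z\<close> is a block of the exponential series.\<close>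

lemma fock_taylor_remainder:
  assumes f: "f \<in> fock_space" and c: "\<And>z. (\<lambda>k. c k * z ^ k) sums f z"
  shows "(cmod (f z - (\<Sum>k<n. c k * z ^ k)))\<^sup>2 \<le> (fock_norm f)\<^sup>2 * exp_tail n (pi * (cmod z)\<^sup>2)"
proof (rule LIMSEQ_le_const2)
  let ?x = "pi * (cmod z)\<^sup>2"
  let ?P = "\<lambda>N. \<Sum>k<N. c k * z ^ k"
  show "(\<lambda>N. (cmod (?P N - ?P n))\<^sup>2) \<longlonglongrightarrow> (cmod (f z - ?P n))\<^sup>2"
    using c[of z] unfolding sums_def by (intro tendsto_intros)
  show "\<exists>N0. \<forall>N\<ge>N0. (cmod (?P N - ?P n))\<^sup>2 \<le> (fock_norm f)\<^sup>2 * exp_tail n ?x"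
  proof (intro exI[of _ n] allI impI)
    fix N assume N: "n \<le> N"
    have split: "(\<Sum>k<N. g k) = (\<Sum>k<n. g k) + (\<Sum>k\<in>{n..<N}. g k)" for g :: "nat \<Rightarrow> 'a::comm_monoid_add"
      using N by (metis atLeast0LessThan sum.atLeastLessThan_concat zero_le)
    define a where "a k = cmod (c k) * sqrt (fact k / pi ^ k)" for k
    define b where "b k = sqrt (?x ^ k / fact k)" for k
    have ab: "cmod (c k * z ^ k) = \<bar>a k\<bar> * \<bar>b k\<bar>" for k
    proof -
      have "a k * b k = cmod (c k) * sqrt ((fact k / pi ^ k) * (?x ^ k / fact k))"
        by (simp only: a_def b_def real_sqrt_mult mult.assoc)
      also have "(fact k / pi ^ k) * (?x ^ k / fact k) = ((cmod z) ^ k)\<^sup>2"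
        by (simp add: power_mult_distrib power_mult[symmetric] mult.commute)
      finally have "a k * b k = cmod (c k) * cmod z ^ k" by simp
      moreover have "0 \<le> a k" "0 \<le> b k"
        by (simp_all add: a_def b_def)
      ultimately show ?thesis
        by (simp add: norm_mult norm_power)
    qed
    have "cmod (?P N - ?P n) \<le> (\<Sum>k\<in>{n..<N}. \<bar>a k\<bar> * \<bar>b k\<bar>)"
      unfolding ab[symmetric] by (simp add: split norm_sum)
    also have "\<dots> \<le> L2_set a {n..<N} * L2_set b {n..<N}"
      by (rule L2_set_mult_ineq)
    finally have "(cmod (?P N - ?P n))\<^sup>2 \<le> (L2_set a {n..<N} * L2_set b {n..<N})\<^sup>2"
      by (intro power_mono) auto
    also have "\<dots> = (\<Sum>k\<in>{n..<N}. (cmod (c k))\<^sup>2 * (fact k / pi ^ k)) * (\<Sum>k\<in>{n..<N}. ?x ^ k / fact k)"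
      by (simp add: power_mult_distrib L2_set_def sum_nonneg a_def b_def)
    also have "\<dots> \<le> (fock_norm f)\<^sup>2 * exp_tail n ?x"
    proof (rule mult_mono)
      have "(\<Sum>k\<in>{n..<N}. (cmod (c k))\<^sup>2 * (fact k / pi ^ k)) \<le> (\<Sum>k<N. (cmod (c k))\<^sup>2 * (fact k / pi ^ k))"
        by (intro sum_mono2) auto
      then show "(\<Sum>k\<in>{n..<N}. (cmod (c k))\<^sup>2 * (fact k / pi ^ k)) \<le> (fock_norm f)\<^sup>2"
        using fock_bessel[OF f c, of N] by linarith
      show "(\<Sum>k\<in>{n..<N}. ?x ^ k / fact k) \<le> exp_tail n ?x"
        using exp_partial_sum_le[of ?x N] split[of "\<lambda>k. ?x ^ k / fact k"] by (simp add: exp_tail_def)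
    qed (auto intro: sum_nonneg)
    finally show "(cmod (?P N - ?P n))\<^sup>2 \<le> (fock_norm f)\<^sup>2 * exp_tail n ?x" .
  qed
qed

text \<open>This is the remainder estimate for the empty Taylor polynomial, whose tail is the full
  exponential.\<close>

lemma fock_pointwise_bound:
  assumes f: "f \<in> fock_space"
  shows "cmod (f z) \<le> fock_norm f * exp (pi * (cmod z)\<^sup>2 / 2)"
proof (rule power2_le_imp_le)
  obtain c where c: "\<And>z. (\<lambda>k. c k * z ^ k) sums f z"
    using f entire_power_series[of f] by (auto simp: fock_space_def)
  show "(cmod (f z))\<^sup>2 \<le> (fock_norm f * exp (pi * (cmod z)\<^sup>2 / 2))\<^sup>2"
    using fock_taylor_remainder[OF f c, of z 0]
    by (simp add: exp_tail_def power_mult_distrib exp_double[symmetric])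
qed (simp add: fock_norm_nonneg)

section \<open>The Fock norm and normal families\<close>

lemma fock_space_continuous: "f \<in> fock_space \<Longrightarrow> continuous_on UNIV f"
  by (auto simp: fock_space_def intro: holomorphic_on_imp_continuous_on)

lemma fock_space_measurable: "f \<in> fock_space \<Longrightarrow> f \<in> borel_measurable borel"
  by (intro borel_measurable_continuous_onI fock_space_continuous)

lemma fock_space_integrable:
  "f \<in> fock_space \<Longrightarrow> integrable lborel (\<lambda>z. (cmod (f z))\<^sup>2 * exp (- pi * (cmod z)\<^sup>2))"
  by (simp add: fock_space_def)

lemma fock_norm_scale: "fock_norm (\<lambda>z. c * f z) = cmod c * fock_norm f"
proof -
  have "(fock_norm (\<lambda>z. c * f z))\<^sup>2 = (cmod c * fock_norm f)\<^sup>2"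
    unfolding fock_norm_square power_mult_distrib norm_mult mult.assoc by simp
  then show ?thesis
    by (simp add: power2_eq_iff_nonneg fock_norm_nonneg)
qed

lemma fock_space_scale: "f \<in> fock_space \<Longrightarrow> (\<lambda>z. c * f z) \<in> fock_space"
  by (auto simp: fock_space_def norm_mult power_mult_distrib mult.assoc intro!: holomorphic_intros)

lemma fock_space_0: "(\<lambda>_. 0) \<in> fock_space"
  by (simp add: fock_space_def)

lemma fock_norm_0: "fock_norm (\<lambda>_. 0) = 0"
  by (simp add: fock_norm_def)

text \<open>Young's inequality with a free weight: integrating it first and choosing
  \<open>s\<close> afterwards yields the triangle inequality for the Fock norm.\<close>

lemma norm_add_square_le:
  fixes a b :: "'a::real_normed_vector"
  assumes "s > 0"
  shows "(norm (a + b))\<^sup>2 \<le> (1 + s) * (norm a)\<^sup>2 + (1 + 1 / s) * (norm b)\<^sup>2"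
proof -
  have "(norm (a + b))\<^sup>2 \<le> (norm a + norm b)\<^sup>2"
    by (intro power_mono norm_triangle_ineq) auto
  also have "\<dots> \<le> (1 + s) * (norm a)\<^sup>2 + (1 + 1 / s) * (norm b)\<^sup>2"
  proof -
    have "0 \<le> (s * norm a - norm b)\<^sup>2 / s"
      using assms by simp
    also have "\<dots> = (1 + s) * (norm a)\<^sup>2 + (1 + 1 / s) * (norm b)\<^sup>2 - (norm a + norm b)\<^sup>2"
      using assms by (simp add: power2_eq_square field_simps)
    finally show ?thesis by simp
  qed
  finally show ?thesis .
qed

lemma
  assumes f: "f \<in> fock_space" and g: "g \<in> fock_space"
  shows fock_space_add: "(\<lambda>z. f z + g z) \<in> fock_space"
    and fock_norm_triangle: "fock_norm (\<lambda>z. f z + g z) \<le> fock_norm f + fock_norm g"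
proof -
  let ?e = "\<lambda>z. exp (- pi * (cmod z)\<^sup>2)"
  note [measurable] = fock_space_measurable[OF f] fock_space_measurable[OF g]
  note fi = fock_space_integrable[OF f] and gi = fock_space_integrable[OF g]
  have bnd: "(cmod (f z + g z))\<^sup>2 * ?e z
      \<le> (1 + s) * ((cmod (f z))\<^sup>2 * ?e z) + (1 + 1 / s) * ((cmod (g z))\<^sup>2 * ?e z)" if "s > 0" for s z
    using mult_right_mono[OF norm_add_square_le[OF that, of "f z" "g z"], of "?e z"]
    by (simp add: algebra_simps)
  have bi: "integrable lborel (\<lambda>z. (1 + s) * ((cmod (f z))\<^sup>2 * ?e z) + (1 + 1 / s) * ((cmod (g z))\<^sup>2 * ?e z))" for s
    by (intro Bochner_Integration.integrable_add integrable_mult_right fi gi)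
  have int: "integrable lborel (\<lambda>z. (cmod (f z + g z))\<^sup>2 * ?e z)"
  proof (rule Bochner_Integration.integrable_bound[OF bi[of 1]])
    show "AE z in lborel. norm ((cmod (f z + g z))\<^sup>2 * ?e z)
        \<le> norm ((1 + 1) * ((cmod (f z))\<^sup>2 * ?e z) + (1 + 1 / 1) * ((cmod (g z))\<^sup>2 * ?e z))"
      using bnd[of 1] by (intro AE_I2) (auto intro: order.trans)
  qed measurable
  then show "(\<lambda>z. f z + g z) \<in> fock_space"
    using f g by (auto simp: fock_space_def intro!: holomorphic_intros)
  let ?F = "fock_norm f" and ?G = "fock_norm g"
  \<comment> \<open>A vanishing norm has to be treated separately, because the weight chosen below
    is a quotient of the two norms.\<close>
  have zero: "h = (\<lambda>_. 0)" if "h \<in> fock_space" "fock_norm h = 0" for h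
    using fock_pointwise_bound[OF that(1)] that(2) by (auto simp: fun_eq_iff)
  show "fock_norm (\<lambda>z. f z + g z) \<le> ?F + ?G"
  proof (cases "?F = 0 \<or> ?G = 0")
    case True
    then show ?thesis
      using zero[OF f] zero[OF g] by (auto simp: fock_norm_0)
  next
    case False
    then have pos: "?F > 0" "?G > 0"
      using fock_norm_nonneg[of f] fock_norm_nonneg[of g] by auto
    \<comment> \<open>The optimal weight: with it, \<open>(1 + s) * F^2 + (1 + 1 / s) * G^2\<close>
      collapses to \<open>(F + G)^2\<close>.\<close>
    define s where "s = ?G / ?F"
    have s: "s > 0" using pos by (simp add: s_def)
    have "(fock_norm (\<lambda>z. f z + g z))\<^sup>2
        \<le> (LINT z|lborel. (1 + s) * ((cmod (f z))\<^sup>2 * ?e z) + (1 + 1 / s) * ((cmod (g z))\<^sup>2 * ?e z))"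
      unfolding fock_norm_square using bnd[OF s] by (intro integral_mono int bi)
    also have "\<dots> = (1 + s) * ?F\<^sup>2 + (1 + 1 / s) * ?G\<^sup>2"
      unfolding fock_norm_square
      by (subst Bochner_Integration.integral_add, intro integrable_mult_right fi, intro integrable_mult_right gi, simp)
    also have "\<dots> = (?F + ?G)\<^sup>2"
      using pos by (simp add: s_def power2_eq_square field_simps)
    finally show ?thesis
      by (rule power2_le_imp_le) (use pos in simp)
  qed
qed

section \<open>Compactness of bounded sets in the Fock space\<close>

text \<open>The pointwise bound makes the family locally bounded, Montel's theorem extracts a
  locally uniform limit, and Fatou's lemma passes the norm bound to it. Evaluation at moving points
  \<open>\<zeta> j\<close> is included because the nodes of the approximating sets only converge to
  the nodes of the limit.\<close>

lemma fock_normal_family: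
  fixes F :: "nat \<Rightarrow> complex \<Rightarrow> complex"
  assumes F: "\<And>j. F j \<in> fock_space" "\<And>j. fock_norm (F j) \<le> K"
  obtains g r where "g \<in> fock_space" "fock_norm g \<le> K" "strict_mono (r :: nat \<Rightarrow> nat)"
    "\<And>\<zeta> z. \<zeta> \<longlonglongrightarrow> z \<Longrightarrow> (\<lambda>j. F (r j) (\<zeta> j)) \<longlonglongrightarrow> g z"
proof -
  have K: "K \<ge> 0"
    using F(2)[of 0] fock_norm_nonneg[of "F 0"] by linarith
  define H where "H = {h\<in>fock_space. fock_norm h \<le> K}"
  have bdd: "\<exists>B. \<forall>h\<in>H. \<forall>z\<in>S. cmod (h z) \<le> B" if "compact S" for S
  proof -
    from that have "bounded S" by (rule compact_imp_bounded)
    then obtain R where R: "\<And>z. z \<in> S \<Longrightarrow> cmod z \<le> R"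
      by (auto simp: bounded_iff)
    have "cmod (h z) \<le> K * exp (pi * R\<^sup>2 / 2)" if "h \<in> H" "z \<in> S" for h z
    proof -
      have "cmod (h z) \<le> fock_norm h * exp (pi * (cmod z)\<^sup>2 / 2)"
        using that by (intro fock_pointwise_bound) (auto simp: H_def)
      also have "\<dots> \<le> K * exp (pi * R\<^sup>2 / 2)"
        using that R[of z] K by (intro mult_mono) (auto simp: H_def intro!: power_mono)
      finally show ?thesis .
    qed
    then show ?thesis by blast
  qed
  obtain g r where g: "g holomorphic_on UNIV" and r: "strict_mono (r :: nat \<Rightarrow> nat)"
    and lim: "\<And>z. (\<lambda>j. F (r j) z) \<longlonglongrightarrow> g z"
    and ul: "\<And>S. compact S \<Longrightarrow> uniform_limit S (F \<circ> r) g sequentially"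
  proof (rule Montel[of UNIV H F])
    show "range F \<subseteq> H" using F by (auto simp: H_def)
    show "h holomorphic_on UNIV" if "h \<in> H" for h
      using that by (auto simp: H_def fock_space_def)
  qed (use bdd in auto)
  let ?e = "\<lambda>z. exp (- pi * (cmod z)\<^sup>2)"
  have gm[measurable]: "g \<in> borel_measurable borel"
    using g by (intro borel_measurable_continuous_onI holomorphic_on_imp_continuous_on)
  have Fm[measurable]: "F j \<in> borel_measurable borel" for j
    using F(1) by (rule fock_space_measurable)
  have "(\<integral>\<^sup>+z. ennreal ((cmod (g z))\<^sup>2 * ?e z) \<partial>lborel)
      = (\<integral>\<^sup>+z. liminf (\<lambda>j. ennreal ((cmod (F (r j) z))\<^sup>2 * ?e z)) \<partial>lborel)"
    by (intro nn_integral_cong lim_imp_Liminf[symmetric] tendsto_ennrealI tendsto_intros lim) auto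
  also have "\<dots> \<le> liminf (\<lambda>j. \<integral>\<^sup>+z. ennreal ((cmod (F (r j) z))\<^sup>2 * ?e z) \<partial>lborel)"
    by (rule nn_integral_liminf) measurable
  also have "\<dots> \<le> ennreal (K\<^sup>2)"
  proof (rule Liminf_le, simp, rule always_eventually, rule allI)
    fix j
    have "(\<integral>\<^sup>+z. ennreal ((cmod (F (r j) z))\<^sup>2 * ?e z) \<partial>lborel) = ennreal ((fock_norm (F (r j)))\<^sup>2)"
      unfolding fock_norm_square using fock_space_integrable[OF F(1)] by (intro nn_integral_eq_integral) auto
    also have "\<dots> \<le> ennreal (K\<^sup>2)"
      using F(2) by (intro ennreal_leI power_mono fock_norm_nonneg)
    finally show "(\<integral>\<^sup>+z. ennreal ((cmod (F (r j) z))\<^sup>2 * ?e z) \<partial>lborel) \<le> ennreal (K\<^sup>2)" .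
  qed
  finally have le: "(\<integral>\<^sup>+z. ennreal ((cmod (g z))\<^sup>2 * ?e z) \<partial>lborel) \<le> ennreal (K\<^sup>2)" .
  have gi: "integrable lborel (\<lambda>z. (cmod (g z))\<^sup>2 * ?e z)"
    by (rule integrableI_nonneg) (use le in \<open>auto simp: less_top[symmetric] top_unique\<close>)
  then have gf: "g \<in> fock_space"
    using g by (simp add: fock_space_def)
  have "(fock_norm g)\<^sup>2 \<le> K\<^sup>2"
  proof -
    have "ennreal ((fock_norm g)\<^sup>2) \<le> ennreal (K\<^sup>2)"
      unfolding fock_norm_square using le gi by (subst nn_integral_eq_integral[symmetric]) auto
    then show ?thesis by (subst (asm) ennreal_le_iff) auto
  qed
  then have "fock_norm g \<le> K"
    using K by (rule power2_le_imp_le)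
  moreover have "(\<lambda>j. F (r j) (\<zeta> j)) \<longlonglongrightarrow> g z" if \<zeta>: "\<zeta> \<longlonglongrightarrow> z" for \<zeta> z
  proof -
    have ev: "\<forall>\<^sub>F j in sequentially. \<zeta> j \<in> cball z 1"
      using tendstoD[OF \<zeta>, of 1] by (auto elim!: eventually_mono simp: dist_commute)
    have "(\<lambda>j. F (r j) (\<zeta> j) - g (\<zeta> j)) \<longlonglongrightarrow> 0"
    proof (rule tendstoI)
      fix e :: real assume "e > 0"
      with ul[of "cball z 1"] have "\<forall>\<^sub>F j in sequentially. \<forall>x\<in>cball z 1. dist (F (r j) x) (g x) < e"
        by (auto simp: uniform_limit_iff)
      with ev show "\<forall>\<^sub>F j in sequentially. dist (F (r j) (\<zeta> j) - g (\<zeta> j)) 0 < e"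
        by eventually_elim (auto simp: dist_norm)
    qed
    moreover have "(\<lambda>j. g (\<zeta> j)) \<longlonglongrightarrow> g z"
      using continuous_on_tendsto_compose[OF fock_space_continuous[OF gf] \<zeta>] by simp
    ultimately have "(\<lambda>j. (F (r j) (\<zeta> j) - g (\<zeta> j)) + g (\<zeta> j)) \<longlonglongrightarrow> 0 + g z"
      by (rule tendsto_add)
    then show ?thesis by simp
  qed
  ultimately show ?thesis
    using that gf r by blast
qed

section \<open>Uniform constants for interpolation on finite sets\<close>

definition interpolable :: "complex set \<Rightarrow> (complex \<Rightarrow> complex) \<Rightarrow> real \<Rightarrow> bool" where
  "interpolable F a K \<longleftrightarrow> (\<exists>f\<in>fock_space. fock_norm f \<le> K \<and>
     (\<forall>l\<in>F. f l * of_real (exp (- pi * (cmod l)\<^sup>2 / 2)) = a l))"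

abbreviation l2norm :: "complex set \<Rightarrow> (complex \<Rightarrow> complex) \<Rightarrow> real" where
  "l2norm F a \<equiv> L2_set (\<lambda>l. cmod (a l)) F"

lemma interpolable_mono:
  assumes "interpolable F a K" "G \<subseteq> F" "\<And>l. l \<in> G \<Longrightarrow> a l = b l" "K \<le> K'"
  shows "interpolable G b K'"
proof -
  from assms(1) obtain f where "f \<in> fock_space" "fock_norm f \<le> K"
    "\<And>l. l \<in> F \<Longrightarrow> f l * of_real (exp (- pi * (cmod l)\<^sup>2 / 2)) = a l"
    unfolding interpolable_def by blast
  with assms(2-) show ?thesis
    unfolding interpolable_def by (intro bexI[of _ f]) (auto intro: order.trans)
qed

lemma interpolable_0: "interpolable F (\<lambda>_. 0) 0"
  unfolding interpolable_def by (rule bexI[OF _ fock_space_0]) (auto simp: fock_norm_0)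

lemma interpolable_add:
  assumes "interpolable F a K" "interpolable F b K'"
  shows "interpolable F (\<lambda>l. a l + b l) (K + K')"
proof -
  from assms obtain f g where
    f: "f \<in> fock_space" "fock_norm f \<le> K" "\<And>l. l \<in> F \<Longrightarrow> f l * of_real (exp (- pi * (cmod l)\<^sup>2 / 2)) = a l" and
    g: "g \<in> fock_space" "fock_norm g \<le> K'" "\<And>l. l \<in> F \<Longrightarrow> g l * of_real (exp (- pi * (cmod l)\<^sup>2 / 2)) = b l"
    unfolding interpolable_def by blast
  show ?thesis
    unfolding interpolable_def
    by (rule bexI[OF _ fock_space_add[OF f(1) g(1)]])
      (use f g fock_norm_triangle[OF f(1) g(1)] in \<open>auto simp: distrib_right\<close>)
qed

lemma interpolable_scale:
  assumes "interpolable F a K"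
  shows "interpolable F (\<lambda>l. c * a l) (cmod c * K)"
proof -
  from assms obtain f where
    f: "f \<in> fock_space" "fock_norm f \<le> K" "\<And>l. l \<in> F \<Longrightarrow> f l * of_real (exp (- pi * (cmod l)\<^sup>2 / 2)) = a l"
    unfolding interpolable_def by blast
  show ?thesis
    unfolding interpolable_def
    by (rule bexI[OF _ fock_space_scale[OF f(1), of c]])
      (use f in \<open>auto simp: fock_norm_scale mult.assoc intro: mult_left_mono\<close>)
qed

lemma interpolable_diff:
  assumes "interpolable F a K" "interpolable F b K'"
  shows "interpolable F (\<lambda>l. a l - b l) (K + K')"
  using interpolable_add[OF assms(1) interpolable_scale[OF assms(2), of "-1"]] by simp

text \<open>Linear combinations of solutions for one-point data give a constant that may depend on
  \<open>F\<close>. It serves to show that failure of interpolation with a given bound persists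
  under small perturbations.\<close>

lemma interpolable_finite:
  assumes \<Lambda>: "fock_interpolating \<Lambda>" and F: "finite F" "F \<subseteq> \<Lambda>"
  obtains C where "C \<ge> 0" "\<And>a. interpolable F a (C * l2norm F a)"
proof -
  have "\<exists>N. interpolable F (\<lambda>x. if x = l then 1 else 0) N" if "l \<in> F" for l
  proof -
    have "(\<lambda>x. (cmod (if x = l then 1 else 0))\<^sup>2) summable_on \<Lambda>"
      by (rule finite_nonzero_values_imp_summable_on) (auto intro: finite_subset[of _ "{l}"])
    then obtain f where "f \<in> fock_space"
      "\<forall>x\<in>\<Lambda>. f x * of_real (exp (- pi * (cmod x)\<^sup>2 / 2)) = (if x = l then 1 else 0)"
      using \<Lambda>[unfolded fock_interpolating_def, rule_format, of "\<lambda>x. if x = l then 1 else 0"] by auto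
    then have "\<forall>x\<in>F. f x * of_real (exp (- pi * (cmod x)\<^sup>2 / 2)) = (if x = l then 1 else 0)"
      using F by blast
    with \<open>f \<in> fock_space\<close> show ?thesis
      unfolding interpolable_def by blast
  qed
  then obtain N where N: "\<And>l. l \<in> F \<Longrightarrow> interpolable F (\<lambda>x. if x = l then 1 else 0) (N l)"
    by metis
  have N0: "N l \<ge> 0" if "l \<in> F" for l
    using N[OF that] fock_norm_nonneg unfolding interpolable_def by (meson order.trans)
  have part: "interpolable F (\<lambda>x. if x \<in> G then a x else 0) (\<Sum>l\<in>G. cmod (a l) * N l)" if "G \<subseteq> F" for G a
    using finite_subset[OF that F(1)] that
  proof (induction G)
    case empty
    then show ?case using interpolable_0 by simp
  next
    case (insert l G)
    have "interpolable F (\<lambda>x. a l * (if x = l then 1 else 0) + (if x \<in> G then a x else 0))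
       (cmod (a l) * N l + (\<Sum>l\<in>G. cmod (a l) * N l))"
      using insert by (intro interpolable_add interpolable_scale N) auto
    then show ?case
      by (rule interpolable_mono) (use insert in auto)
  qed
  show ?thesis
  proof
    show "(\<Sum>l\<in>F. N l) \<ge> 0"
      using N0 by (intro sum_nonneg)
    fix a
    show "interpolable F a ((\<Sum>l\<in>F. N l) * l2norm F a)"
    proof (rule interpolable_mono[OF part[OF order.refl]])
      show "(\<Sum>l\<in>F. cmod (a l) * N l) \<le> (\<Sum>l\<in>F. N l) * l2norm F a"
        unfolding sum_distrib_right
        using N0 F(1) member_le_L2_set[OF F(1), of _ "\<lambda>l. cmod (a l)"]
        by (intro sum_mono) (auto simp: mult.commute intro: mult_left_mono)
    qed auto
  qed
qed

section \<open>The gliding hump argument\<close>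

lemma l2norm_scale: "l2norm F (\<lambda>l. c * a l) = cmod c * l2norm F a"
  by (simp add: norm_mult L2_set_right_distrib)

lemma l2norm_triangle: "l2norm F (\<lambda>l. a l + b l) \<le> l2norm F a + l2norm F b"
  by (rule order.trans[OF L2_set_mono L2_set_triangle_ineq]) (auto intro: norm_triangle_ineq)

text \<open>The inductive step of the gliding hump argument.\<close>

lemma hump_step:
  assumes \<Lambda>: "fock_interpolating \<Lambda>"
    and unif: "\<not> (\<exists>C. \<forall>F a. finite F \<longrightarrow> F \<subseteq> \<Lambda> \<longrightarrow> interpolable F a (C * l2norm F a))"
    and r: "r > 0" and m: "m \<ge> 0"
  shows "\<exists>x' r'. 0 < r' \<and> r' \<le> r / 2 \<and> (\<forall>G. finite G \<longrightarrow> l2norm G (\<lambda>l. x' l - x l) \<le> r / 2) \<and>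
    (\<exists>F. finite F \<and> F \<subseteq> \<Lambda> \<and> (\<forall>y. l2norm F (\<lambda>l. x' l - y l) \<le> r' \<longrightarrow> \<not> interpolable F y m))"
proof -
  obtain F a where F: "finite F" "F \<subseteq> \<Lambda>" and a: "\<not> interpolable F a (2 * (m + 1) / r * l2norm F a)"
    using unif by metis
  define t where "t = l2norm F a"
  have t: "t > 0"
  proof (rule ccontr)
    assume "\<not> t > 0"
    then have "t = 0" using L2_set_nonneg[of _ F] unfolding t_def by (simp add: order.antisym not_less)
    then have "\<And>l. l \<in> F \<Longrightarrow> a l = 0"
      using F(1) by (simp add: t_def L2_set_eq_0_iff)
    then have "interpolable F a 0"
      by (intro interpolable_mono[OF interpolable_0]) auto
    with a \<open>t = 0\<close> show False by (simp add: t_def)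
  qed
  \<comment> \<open>The bad data \<open>a\<close>, rescaled to length \<open>r / 2\<close> and
    extended by zero so that the length is under control on every finite set. The constant
    \<open>2 * (m + 1) / r\<close> was chosen so that \<open>b\<close> is not interpolable with
    bound \<open>m + 1\<close>.\<close>
  define b where "b = (\<lambda>l. if l \<in> F then of_real (r / (2 * t)) * a l else 0)"
  have bG: "l2norm G b \<le> r / 2" if "finite G" for G
  proof -
    have "l2norm G b = l2norm (G \<inter> F) b"
      unfolding L2_set_def using that by (intro arg_cong[where f=sqrt] sum.mono_neutral_right) (auto simp: b_def)
    also have "\<dots> \<le> l2norm F b"
      unfolding L2_set_def using F(1) by (intro real_sqrt_le_mono sum_mono2) auto
    also have "\<dots> = l2norm F (\<lambda>l. of_real (r / (2 * t)) * a l)"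
      by (intro L2_set_cong) (auto simp: b_def)
    also have "\<dots> = r / 2"
      unfolding l2norm_scale t_def[symmetric] using t r by (simp add: norm_divide norm_mult)
    finally show ?thesis .
  qed
  have b: "\<not> interpolable F b (m + 1)"
  proof
    assume "interpolable F b (m + 1)"
    then have "interpolable F (\<lambda>l. of_real (2 * t / r) * b l) (cmod (of_real (2 * t / r)) * (m + 1))"
      by (rule interpolable_scale)
    then have "interpolable F a (2 * (m + 1) / r * l2norm F a)"
      by (rule interpolable_mono) (use t r in \<open>auto simp: b_def t_def[symmetric] norm_divide norm_mult field_simps\<close>)
    with a show False ..
  qed
  \<comment> \<open>If both shifts of \<open>x\<close> were interpolable with bound
    \<open>m + 1\<close>, so would be half their difference, which is \<open>b\<close>. Hence one
    shift is bad, whatever \<open>x\<close> is.\<close>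
  have "\<not> interpolable F (\<lambda>l. x l + b l) (m + 1) \<or> \<not> interpolable F (\<lambda>l. x l - b l) (m + 1)"
  proof (rule ccontr)
    assume "\<not> ?thesis"
    then have "interpolable F (\<lambda>l. x l + b l) (m + 1)" "interpolable F (\<lambda>l. x l - b l) (m + 1)" by auto
    from interpolable_scale[OF interpolable_diff[OF this], of "1/2"]
    have "interpolable F b (m + 1)"
      by (rule interpolable_mono) auto
    with b show False ..
  qed
  then obtain x' where x': "\<not> interpolable F x' (m + 1)" and x'b: "x' = (\<lambda>l. x l + b l) \<or> x' = (\<lambda>l. x l - b l)"
    by blast
  have x'x: "l2norm G (\<lambda>l. x' l - x l) \<le> r / 2" if "finite G" for G
    using x'b bG[OF that] by auto
  obtain C where C: "C \<ge> 0" "\<And>a. interpolable F a (C * l2norm F a)"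
    using interpolable_finite[OF \<Lambda> F] by blast
  \<comment> \<open>A perturbation of length at most \<open>1 / (C + 1)\<close> can be interpolated
    at cost less than 1, so all data within \<open>r'\<close> of \<open>x'\<close> stay out of reach
    of the bound \<open>m\<close>.\<close>
  define r' where "r' = min (r / 2) (1 / (C + 1))"
  have "\<not> interpolable F y m" if y: "l2norm F (\<lambda>l. x' l - y l) \<le> r'" for y
  proof
    assume "interpolable F y m"
    from interpolable_add[OF this C(2)[of "\<lambda>l. x' l - y l"]]
    have "interpolable F x' (m + 1)"
    proof (rule interpolable_mono)
      have "C * l2norm F (\<lambda>l. x' l - y l) \<le> C * (1 / (C + 1))"
        using y C(1) by (intro mult_left_mono) (auto simp: r'_def)
      also have "\<dots> \<le> 1"
        using C(1) by (simp add: field_simps)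
      finally show "m + C * l2norm F (\<lambda>l. x' l - y l) \<le> m + 1" by simp
    qed auto
    with x' show False ..
  qed
  moreover have "0 < r'" "r' \<le> r / 2"
    using r C(1) by (auto simp: r'_def)
  ultimately show ?thesis
    using x'x F by blast
qed

text \<open>If no constant worked, nested balls of data could be built, the step from
  \<open>n\<close> to \<open>n + 1\<close> excluding the bound \<open>n\<close>. Their common point
  \<open>y\<close> is square summable, hence interpolated by some function of finite norm, a
  contradiction.\<close>

lemma fock_interpolating_uniform:
  assumes \<Lambda>: "fock_interpolating \<Lambda>"
  obtains C where "C > 0" "\<And>F a. finite F \<Longrightarrow> F \<subseteq> \<Lambda> \<Longrightarrow> interpolable F a (C * l2norm F a)"
proof (cases "\<exists>C. \<forall>F a. finite F \<longrightarrow> F \<subseteq> \<Lambda> \<longrightarrow> interpolable F a (C * l2norm F a)")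
  case True
  then obtain C where C: "\<And>F a. finite F \<Longrightarrow> F \<subseteq> \<Lambda> \<Longrightarrow> interpolable F a (C * l2norm F a)"
    by blast
  show ?thesis
  proof (rule that[of "max C 1"])
    fix F a assume "finite F" "F \<subseteq> \<Lambda>"
    from C[OF this, of a] show "interpolable F a (max C 1 * l2norm F a)"
      by (rule interpolable_mono) (auto intro!: mult_right_mono)
  qed simp
next
  case False
  \<comment> \<open>A pair is the centre and radius of a ball of data. Moving the centre by at most
    \<open>r / 2\<close> and at least halving the radius keeps the new ball inside the old one.
    Lengths are measured on all finite sets \<open>G\<close> in place of an infinite sum.\<close>
  define Q where "Q = (\<lambda>(n::nat) (x, r) (x', r'). 0 < r' \<and> r' \<le> r / (2::real) \<and>
    (\<forall>G. finite G \<longrightarrow> l2norm G (\<lambda>l. x' l - x l) \<le> r / 2) \<and>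
    (\<exists>F. finite F \<and> F \<subseteq> \<Lambda> \<and> (\<forall>y. l2norm F (\<lambda>l. x' l - y l) \<le> r' \<longrightarrow> \<not> interpolable F y (real n))))"
  have "\<exists>s. \<forall>n. (snd (s n) > 0 \<and> (n = 0 \<longrightarrow> s n = (\<lambda>_. 0, 1))) \<and> Q n (s n) (s (Suc n))"
  proof (rule dependent_nat_choice)
    show "\<exists>s :: (complex \<Rightarrow> complex) \<times> real. snd s > 0 \<and> ((0::nat) = 0 \<longrightarrow> s = (\<lambda>_. 0, 1))"
      by (rule exI[of _ "(\<lambda>_. 0, 1)"]) simp
  next
    fix s :: "(complex \<Rightarrow> complex) \<times> real" and n :: nat
    assume s: "snd s > 0 \<and> (n = 0 \<longrightarrow> s = (\<lambda>_. 0, 1))"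
    show "\<exists>s'. (snd s' > 0 \<and> (Suc n = 0 \<longrightarrow> s' = (\<lambda>_. 0, 1))) \<and> Q n s s'"
      using hump_step[OF \<Lambda> False, of "snd s" "real n" "fst s"] s
      unfolding Q_def by (auto simp: case_prod_unfold)
  qed
  then obtain s where s: "\<And>n. snd (s n) > 0" "s 0 = (\<lambda>_. 0, 1)" "\<And>n. Q n (s n) (s (Suc n))"
    by metis
  define x where "x n = fst (s n)" for n
  define r where "r n = snd (s n)" for n
  have r0: "r n > 0" for n using s(1) by (simp add: r_def)
  have r_half: "r (Suc n) \<le> r n / 2" for n
    using s(3)[of n] by (auto simp: Q_def r_def case_prod_unfold)
  have x_step: "l2norm G (\<lambda>l. x (Suc n) l - x n l) \<le> r n / 2" if "finite G" for n G
    using s(3)[of n] that by (auto simp: Q_def r_def x_def case_prod_unfold)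
  have bad: "\<exists>F. finite F \<and> F \<subseteq> \<Lambda> \<and> (\<forall>y. l2norm F (\<lambda>l. x (Suc n) l - y l) \<le> r (Suc n) \<longrightarrow> \<not> interpolable F y (real n))" for n
    using s(3)[of n] by (auto simp: Q_def r_def x_def case_prod_unfold)
  \<comment> \<open>The telescoping form works because halving gives
    \<open>r (n + k) / 2 <= r (n + k) - r (n + k + 1)\<close>. It yields both the Cauchy property
    and membership of the limit in every ball.\<close>
  have x_dist: "l2norm G (\<lambda>l. x (n + k) l - x n l) \<le> r n - r (n + k)" if "finite G" for n k G
  proof (induction k)
    case (Suc k)
    have "l2norm G (\<lambda>l. x (n + Suc k) l - x n l) \<le> l2norm G (\<lambda>l. x (Suc (n + k)) l - x (n + k) l) + l2norm G (\<lambda>l. x (n + k) l - x n l)"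
      using l2norm_triangle[where F = G and a = "\<lambda>l. x (Suc (n + k)) l - x (n + k) l" and b = "\<lambda>l. x (n + k) l - x n l"] by simp
    also have "\<dots> \<le> r (n + k) / 2 + (r n - r (n + k))"
      using x_step[OF that, of "n + k"] Suc by simp
    also have "\<dots> \<le> r n - r (n + Suc k)"
      using r_half[of "n + k"] by simp
    finally show ?case .
  qed (auto simp: L2_set_def)
  have r_lim: "r n \<le> (1 / 2) ^ n" for n
  proof (induction n)
    case 0
    then show ?case by (simp add: r_def s)
  next
    case (Suc n)
    then show ?case using r_half[of n] by simp
  qed
  have "\<exists>y. (\<lambda>n. x n l) \<longlonglongrightarrow> y" for l
  proof -
    have "Cauchy (\<lambda>n. x n l)"
    proof (rule CauchyI')
      fix e :: real assume "e > 0"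
      then obtain M where M: "(1 / 2) ^ M < e"
        using real_arch_pow_inv[of e "1/2"] by auto
      have "dist (x n l) (x k l) < e" if "M \<le> n" "n < k" for n k
      proof -
        have "dist (x n l) (x k l) = l2norm {l} (\<lambda>l. x k l - x n l)"
          by (simp add: L2_set_def dist_norm norm_minus_commute)
        also have "\<dots> \<le> r n - r k"
          using x_dist[of "{l}" n "k - n"] that by simp
        also have "\<dots> < (1 / 2) ^ n"
          using r_lim[of n] r0[of k] by simp
        also have "\<dots> \<le> (1 / 2) ^ M"
          using that by (intro power_decreasing) auto
        finally show ?thesis using M by simp
      qed
      then show "\<exists>M. \<forall>n\<ge>M. \<forall>k>n. dist (x n l) (x k l) < e" by blast
    qed
    then show ?thesis by (simp add: Cauchy_convergent_iff convergent_def)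
  qed
  then obtain y where y: "\<And>l. (\<lambda>n. x n l) \<longlonglongrightarrow> y l"
    by metis
  have xy: "l2norm G (\<lambda>l. x n l - y l) \<le> r n" if "finite G" for G n
  proof (rule LIMSEQ_le_const2)
    have "(\<lambda>k. x (n + k) l) \<longlonglongrightarrow> y l" for l
      using LIMSEQ_ignore_initial_segment[OF y[of l], of n] by (simp add: add.commute)
    then show "(\<lambda>k. l2norm G (\<lambda>l. x n l - x (n + k) l)) \<longlonglongrightarrow> l2norm G (\<lambda>l. x n l - y l)"
      unfolding L2_set_def by (intro tendsto_intros)
    have "l2norm G (\<lambda>l. x n l - x (n + k) l) \<le> r n" for k
      using x_dist[OF that, of n k] r0[of "n + k"] by (subst norm_minus_commute) simp
    then show "\<exists>N. \<forall>k\<ge>N. l2norm G (\<lambda>l. x n l - x (n + k) l) \<le> r n" by blast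
  qed
  have "(\<lambda>l. (cmod (y l))\<^sup>2) summable_on \<Lambda>"
  proof (rule nonneg_bdd_above_summable_on)
    have "(\<Sum>l\<in>G. (cmod (y l))\<^sup>2) \<le> 1" if "finite G" for G
    proof -
      have "l2norm G y \<le> 1"
        using xy[OF that, of 0] by (simp add: x_def r_def s)
      then show ?thesis by (simp add: L2_set_def)
    qed
    then show "bdd_above (sum (\<lambda>l. (cmod (y l))\<^sup>2) ` {F. F \<subseteq> \<Lambda> \<and> finite F})"
      by (intro bdd_aboveI[of _ 1]) auto
  qed auto
  then obtain f where f: "f \<in> fock_space" "\<forall>l\<in>\<Lambda>. f l * of_real (exp (- pi * (cmod l)\<^sup>2 / 2)) = y l"
    using \<Lambda> unfolding fock_interpolating_def by meson
  \<comment> \<open>The ball around \<open>x (Suc n)\<close> excludes the bound \<open>n\<close>;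
    since \<open>y\<close> lies in it, any \<open>n\<close> above the norm of \<open>f\<close> gives
    the contradiction.\<close>
  obtain n where n: "fock_norm f \<le> real n"
    using real_arch_simple by blast
  have "interpolable F y (real n)" if "F \<subseteq> \<Lambda>" for F
    using f n that unfolding interpolable_def by blast
  with bad[of n] xy[of _ "Suc n"] show ?thesis by blast
qed

section \<open>Separation, and tails of the exponential series\<close>

text \<open>After recentring, the weighted modulus of \<open>f\<close> is comparable to that of a
  holomorphic function on the unit disc around \<open>\<mu>\<close>, so Schwarz's lemma applies to
  the zero at \<open>\<mu>\<close>.\<close>

lemma fock_Schwarz:
  assumes f: "f \<in> fock_space" and f0: "f \<mu> = 0" and z: "cmod (z - \<mu>) < 1"
  shows "cmod (f z) * exp (- pi * (cmod z)\<^sup>2 / 2) \<le> (fock_norm f * exp (pi / 2) + 1) * cmod (z - \<mu>)"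
proof -
  \<comment> \<open>This factor recentres the Gaussian weight at \<open>\<mu>\<close>, up to a unimodular factor.\<close>
  define g where "g w = f w * exp (- of_real pi * cnj \<mu> * w) * of_real (exp (pi * (cmod \<mu>)\<^sup>2 / 2))" for w
  have g_norm: "cmod (g w) = cmod (f w) * exp (- pi * (cmod w)\<^sup>2 / 2) * exp (pi * (cmod (w - \<mu>))\<^sup>2 / 2)" for w
  proof -
    have eq: "(cmod (w - \<mu>))\<^sup>2 = (cmod w)\<^sup>2 + (cmod \<mu>)\<^sup>2 - 2 * Re (cnj \<mu> * w)"
      by (simp only: cmod_power2) (simp add: power2_eq_square algebra_simps)
    have "- pi * Re (cnj \<mu> * w) + pi * (cmod \<mu>)\<^sup>2 / 2 = - pi * (cmod w)\<^sup>2 / 2 + pi * (cmod (w - \<mu>))\<^sup>2 / 2"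
      unfolding eq by (simp add: field_simps)
    then have "exp (- pi * Re (cnj \<mu> * w)) * exp (pi * (cmod \<mu>)\<^sup>2 / 2)
        = exp (- pi * (cmod w)\<^sup>2 / 2) * exp (pi * (cmod (w - \<mu>))\<^sup>2 / 2)"
      by (simp only: exp_add[symmetric])
    then show ?thesis
      by (simp add: g_def norm_mult mult.assoc)
  qed
  \<comment> \<open>\<open>exp (pi / 2)\<close> bounds the factor lost by recentring on the unit
    disc; adding 1 supplies the strict bound in Schwarz's lemma and makes \<open>M\<close> positive
    even for \<open>f = 0\<close>.\<close>
  define M where "M = fock_norm f * exp (pi / 2) + 1"
  have M: "M > 0"
    using fock_norm_nonneg[of f] by (simp add: M_def add_nonneg_pos)
  define h where "h w = g (\<mu> + w) / of_real M" for w
  have "cmod (h (z - \<mu>)) \<le> cmod (z - \<mu>)"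
  proof (rule Schwarz_Lemma(1))
    have "f holomorphic_on UNIV"
      using f by (simp add: fock_space_def)
    then have "(\<lambda>w. f (\<mu> + w)) holomorphic_on ball 0 1"
      by (intro holomorphic_on_compose_gen[of "\<lambda>w. \<mu> + w" _ f UNIV, unfolded o_def] holomorphic_intros) auto
    then show "h holomorphic_on ball 0 1"
      unfolding h_def g_def using M by (intro holomorphic_intros) auto
    show "h 0 = 0"
      by (simp add: h_def g_def f0)
    show "cmod (h w) < 1" if "cmod w < 1" for w
    proof -
      have "cmod (g (\<mu> + w)) = (cmod (f (\<mu> + w)) * exp (- pi * (cmod (\<mu> + w))\<^sup>2 / 2)) * exp (pi * (cmod w)\<^sup>2 / 2)"
        by (simp add: g_norm)
      also have "\<dots> \<le> fock_norm f * exp (pi / 2)"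
      proof (rule mult_mono)
        show "cmod (f (\<mu> + w)) * exp (- pi * (cmod (\<mu> + w))\<^sup>2 / 2) \<le> fock_norm f"
          using fock_pointwise_bound[OF f, of "\<mu> + w"] by (simp add: exp_minus field_simps)
        show "exp (pi * (cmod w)\<^sup>2 / 2) \<le> exp (pi / 2)"
          using that by (simp add: power_le_one)
      qed (auto simp: fock_norm_nonneg)
      also have "\<dots> < M"
        by (simp add: M_def)
      finally show ?thesis
        using M by (simp add: h_def norm_divide)
    qed
    show "cmod (z - \<mu>) < 1" by (rule z)
  qed
  then have "cmod (g z) \<le> M * cmod (z - \<mu>)"
    using M by (simp add: h_def norm_divide field_simps)
  moreover have "cmod (f z) * exp (- pi * (cmod z)\<^sup>2 / 2) \<le> cmod (g z)"
    unfolding g_norm using mult_left_mono[of 1 "exp (pi * (cmod (z - \<mu>))\<^sup>2 / 2)" "cmod (f z) * exp (- pi * (cmod z)\<^sup>2 / 2)"]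
    by simp
  ultimately show ?thesis
    by (simp add: M_def)
qed

text \<open>A function of norm at most \<open>K\<close> cannot rise from 0 at \<open>\<mu>\<close>
  to weighted modulus 1 at \<open>l\<close> too quickly. Points at distance at least 1 satisfy the
  bound trivially.\<close>

lemma interpolable_separation:
  assumes "interpolable {l, \<mu>} (\<lambda>x. if x = l then 1 else 0) K" "l \<noteq> \<mu>"
  shows "1 / (K * exp (pi / 2) + 1) \<le> cmod (l - \<mu>)"
proof -
  obtain f where f: "f \<in> fock_space" "fock_norm f \<le> K"
    and fl: "f l * of_real (exp (- pi * (cmod l)\<^sup>2 / 2)) = 1" and fm: "f \<mu> = 0"
    using assms unfolding interpolable_def by auto
  have K: "K \<ge> 0"
    using f(2) fock_norm_nonneg[of f] by linarith
  then have pos: "K * exp (pi / 2) + 1 > 0"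
    by (simp add: add_nonneg_pos)
  show ?thesis
  proof (cases "cmod (l - \<mu>) < 1")
    case True
    have "1 = cmod (f l * of_real (exp (- pi * (cmod l)\<^sup>2 / 2)))"
      unfolding fl by simp
    also have "\<dots> = cmod (f l) * exp (- pi * (cmod l)\<^sup>2 / 2)"
      by (simp add: norm_mult)
    also have "\<dots> \<le> (fock_norm f * exp (pi / 2) + 1) * cmod (l - \<mu>)"
      by (rule fock_Schwarz[OF f(1) fm True])
    also have "\<dots> \<le> (K * exp (pi / 2) + 1) * cmod (l - \<mu>)"
      using f(2) by (intro mult_right_mono add_right_mono) auto
    finally show ?thesis
      using pos by (simp add: field_simps)
  next
    case False
    have "1 / (K * exp (pi / 2) + 1) \<le> 1"
      using K by (simp add: divide_le_eq_1_pos[OF pos])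
    with False show ?thesis by linarith
  qed
qed

section \<open>Counting separated points\<close>

text \<open>A grid of squares of side \<open>\<delta> / 2\<close> has at most one point of
  \<open>S\<close> in each cell: coordinates in a common cell differ by less than
  \<open>\<delta> / 2\<close> each. The cells meeting the disc are then counted.\<close>

lemma separated_card:
  fixes S :: "complex set"
  assumes \<delta>: "\<delta> > 0" and sep: "\<And>x y. x \<in> S \<Longrightarrow> y \<in> S \<Longrightarrow> x \<noteq> y \<Longrightarrow> \<delta> \<le> cmod (x - y)" and R: "R \<ge> 0"
  shows "finite (S \<inter> cball 0 R)" "real (card (S \<inter> cball 0 R)) \<le> (4 * R / \<delta> + 2)\<^sup>2"
proof -
  define s where "s = \<delta> / 2"
  have s: "s > 0" using \<delta> by (simp add: s_def)
  define \<phi> where "\<phi> z = (\<lfloor>Re z / s\<rfloor>, \<lfloor>Im z / s\<rfloor>)" for z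
  define I where "I = {\<lfloor>- R / s\<rfloor>..\<lfloor>R / s\<rfloor>}"
  have close: "\<bar>a - b\<bar> < s" if "\<lfloor>a / s\<rfloor> = \<lfloor>b / s\<rfloor>" for a b :: real
  proof -
    have "\<bar>a / s - b / s\<bar> < 1"
      using that by linarith
    then show ?thesis
      using s by (simp add: diff_divide_distrib[symmetric] abs_divide)
  qed
  have inj: "inj_on \<phi> (S \<inter> cball 0 R)"
  proof (rule inj_onI, rule ccontr)
    fix x y assume xy: "x \<in> S \<inter> cball 0 R" "y \<in> S \<inter> cball 0 R" "\<phi> x = \<phi> y" "x \<noteq> y"
    have "cmod (x - y) \<le> \<bar>Re x - Re y\<bar> + \<bar>Im x - Im y\<bar>"
      using cmod_le[of "x - y"] by simp
    also have "\<dots> < s + s"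
      using xy(3) by (intro add_strict_mono close) (auto simp: \<phi>_def)
    finally show False
      using sep[of x y] xy by (simp add: s_def)
  qed
  have sub: "\<phi> ` (S \<inter> cball 0 R) \<subseteq> I \<times> I"
  proof -
    have "\<lfloor>a / s\<rfloor> \<in> I" if "\<bar>a\<bar> \<le> R" for a
    proof -
      have "- R / s \<le> a / s" "a / s \<le> R / s"
        using that s by (intro divide_right_mono; simp)+
      then show ?thesis
        unfolding I_def by (simp add: floor_mono)
    qed
    then show ?thesis
      unfolding \<phi>_def using abs_Re_le_cmod abs_Im_le_cmod by (fastforce intro: order.trans)
  qed
  have finI: "finite (I \<times> I)" by (simp add: I_def)
  show "finite (S \<inter> cball 0 R)"
    using inj_on_finite[OF inj sub finI] .
  have "card (S \<inter> cball 0 R) \<le> card (I \<times> I)"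
    using card_inj_on_le[OF inj sub finI] .
  then have "real (card (S \<inter> cball 0 R)) \<le> real (card I) * real (card I)"
    unfolding card_cartesian_product using of_nat_mono by fastforce
  also have "\<dots> \<le> (4 * R / \<delta> + 2) * (4 * R / \<delta> + 2)"
  proof -
    have "\<lfloor>- R / s\<rfloor> \<le> \<lfloor>R / s\<rfloor>"
      using R s by (intro floor_mono) (simp add: field_simps)
    then have "real (card I) = of_int (\<lfloor>R / s\<rfloor> + 1 - \<lfloor>- R / s\<rfloor>)"
      by (simp add: I_def)
    also have "\<dots> \<le> R / s + 1 - (- R / s - 1)"
      by linarith
    also have "\<dots> = 4 * R / \<delta> + 2"
      using \<delta> by (simp add: s_def)
    finally show ?thesis
      by (intro mult_mono) auto
  qed
  finally show "real (card (S \<inter> cball 0 R)) \<le> (4 * R / \<delta> + 2)\<^sup>2"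
    by (simp add: power2_eq_square)
qed

section \<open>Upper tails of the Poisson distribution\<close>

text \<open>The quadratic term is the source of the Gaussian factor \<open>exp (- s^2 / 2)\<close>
  in the tail bound.\<close>

lemma ln_one_minus_le:
  assumes "0 \<le> v" "v < (1::real)"
  shows "ln (1 - v) \<le> - v - v\<^sup>2 / 2"
proof -
  have "ln (1 - v) + v + v\<^sup>2 / 2 \<le> ln (1 - 0) + 0 + 0\<^sup>2 / 2"
  proof (rule DERIV_nonpos_imp_nonincreasing[OF assms(1)])
    fix x assume x: "0 \<le> x" "x \<le> v"
    have "((\<lambda>v. ln (1 - v) + v + v\<^sup>2 / 2) has_real_derivative (- 1 / (1 - x) + 1 + x)) (at x)"
      using x assms by (auto intro!: derivative_eq_intros)
    moreover have "- 1 / (1 - x) + 1 + x \<le> 0"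
      using x assms by (simp add: field_simps)
    ultimately show "\<exists>y. ((\<lambda>v. ln (1 - v) + v + v\<^sup>2 / 2) has_real_derivative y) (at x) \<and> y \<le> 0"
      by blast
  qed
  then show ?thesis by simp
qed

lemma exp_tail_le_if_sum_le:
  assumes "\<And>N. n \<le> N \<Longrightarrow> (\<Sum>k=n..<N. x ^ k / fact k) \<le> B"
  shows "exp_tail n x \<le> B"
proof (rule LIMSEQ_le_const2)
  show "(\<lambda>N. (\<Sum>k<N. x ^ k / fact k) - (\<Sum>k<n. x ^ k / fact k)) \<longlonglongrightarrow> exp_tail n x"
    unfolding exp_tail_def using exp_converges[of x]
    by (intro tendsto_intros) (simp add: sums_def divide_inverse mult.commute)
  show "\<exists>N0. \<forall>N\<ge>N0. (\<Sum>k<N. x ^ k / fact k) - (\<Sum>k<n. x ^ k / fact k) \<le> B"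
  proof (intro exI[of _ n] allI impI)
    fix N assume N: "n \<le> N"
    have "(\<Sum>k<N. x ^ k / fact k) = (\<Sum>k<n. x ^ k / fact k) + (\<Sum>k=n..<N. x ^ k / fact k)"
      using N by (metis atLeast0LessThan sum.atLeastLessThan_concat zero_le)
    with assms[OF N] show "(\<Sum>k<N. x ^ k / fact k) - (\<Sum>k<n. x ^ k / fact k) \<le> B"
      by simp
  qed
qed

text \<open>Every term of index \<open>k >= n\<close> may be multiplied by
  \<open>\<theta> ^ (k - n) >= 1\<close>; the enlarged terms belong to the series of
  \<open>exp (\<theta> * x)\<close>.\<close>

lemma exp_tail_Chernoff:
  assumes x: "0 \<le> x" and \<theta>: "1 \<le> \<theta>"
  shows "exp_tail n x \<le> exp (\<theta> * x) / \<theta> ^ n"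
proof (rule exp_tail_le_if_sum_le)
  fix N
  have "(\<Sum>k=n..<N. x ^ k / fact k) \<le> (\<Sum>k=n..<N. ((\<theta> * x) ^ k / fact k) / \<theta> ^ n)"
  proof (rule sum_mono)
    fix k assume "k \<in> {n..<N}"
    then have "\<theta> ^ n \<le> \<theta> ^ k"
      using \<theta> by (intro power_increasing) auto
    then have "x ^ k * \<theta> ^ n \<le> x ^ k * \<theta> ^ k"
      using x by (intro mult_left_mono) auto
    then show "x ^ k / fact k \<le> ((\<theta> * x) ^ k / fact k) / \<theta> ^ n"
      using \<theta> by (simp add: field_simps power_mult_distrib)
  qed
  also have "\<dots> \<le> (\<Sum>k<N. ((\<theta> * x) ^ k / fact k) / \<theta> ^ n)"
    using x \<theta> by (intro sum_mono2) auto
  also have "\<dots> \<le> exp (\<theta> * x) / \<theta> ^ n"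
    unfolding sum_divide_distrib[symmetric] using x \<theta> by (intro divide_right_mono exp_partial_sum_le) auto
  finally show "(\<Sum>k=n..<N. x ^ k / fact k) \<le> exp (\<theta> * x) / \<theta> ^ n" .
qed

lemma exp_tail_Suc_le: "0 \<le> x \<Longrightarrow> exp_tail (Suc n) x \<le> exp_tail n x"
  by (simp add: exp_tail_def)

lemma exp_tail_gaussian_bound:
  assumes n: "n > 0" and x: "0 \<le> x" "x \<le> real n - sqrt (real n) * s" and s: "s \<ge> 0"
  shows "exp_tail (Suc n) x \<le> exp x * exp (- s\<^sup>2 / 2)"
proof (cases "x = 0")
  case True
  then have "exp_tail (Suc n) x = 0"
    unfolding exp_tail_def by (subst sum.lessThan_Suc_shift) simp
  then show ?thesis by simp
next
  case False
  with x have x0: "x > 0" by simp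
  \<comment> \<open>The relative distance of \<open>x\<close> from \<open>n\<close>. The hypothesis
    on \<open>x\<close> says that \<open>v >= s / sqrt n\<close>, that is,
    \<open>n * v^2 >= s^2\<close>.\<close>
  define v where "v = 1 - x / real n"
  have xv: "x = real n * (1 - v)"
    using n by (simp add: v_def)
  have "s / sqrt (real n) \<le> v"
  proof -
    have "sqrt (real n) * s \<le> real n * v"
      using x(2) n by (simp add: xv algebra_simps)
    also have "real n * v = sqrt (real n) * (sqrt (real n) * v)"
      by simp
    finally have "s \<le> sqrt (real n) * v"
      using n by (subst (asm) mult_le_cancel_left_pos) auto
    then show ?thesis
      using n by (simp add: pos_divide_le_eq mult.commute)
  qed
  moreover have "0 \<le> s / sqrt (real n)" using s by simp
  ultimately have v: "0 \<le> v" and "(s / sqrt (real n))\<^sup>2 \<le> v\<^sup>2"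
    by (auto intro: power_mono)
  then have nv: "s\<^sup>2 \<le> real n * v\<^sup>2"
    using n by (simp add: power_divide field_simps)
  have v1: "v < 1"
    using x0 n by (simp add: v_def)
  have "exp_tail (Suc n) x \<le> exp_tail n x"
    using x by (intro exp_tail_Suc_le)
  \<comment> \<open>\<open>\<theta> = n / x = 1 / (1 - v)\<close> minimises the Chernoff bound.\<close>
  also have "\<dots> \<le> exp ((1 / (1 - v)) * x) / (1 / (1 - v)) ^ n"
    using x v v1 by (intro exp_tail_Chernoff) auto
  also have "\<dots> = exp (real n) * (1 - v) ^ n"
    using v1 by (simp add: xv power_divide)
  also have "\<dots> = exp (real n + real n * ln (1 - v))"
    using v1 by (simp add: exp_add exp_of_nat_mult)
  also have "\<dots> \<le> exp (x + - s\<^sup>2 / 2)"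
  proof (subst exp_le_cancel_iff)
    have "real n * ln (1 - v) \<le> real n * (- v - v\<^sup>2 / 2)"
      by (intro mult_left_mono ln_one_minus_le v v1) auto
    then show "real n + real n * ln (1 - v) \<le> x + - s\<^sup>2 / 2"
      using nv by (simp add: xv algebra_simps)
  qed
  finally show ?thesis
    by (simp only: exp_add)
qed

section \<open>Interpolation by polynomials\<close>

text \<open>A solver that halves the error is applied to successive residuals; the corrections are
  summed, and their sizes form a geometric series, whence the factor 2. The solver need not be
  linear. With the weights \<open>sqrt (fact k / pi ^ k)\<close> the coefficient norm becomes the
  Fock norm.\<close>

lemma finite_neumann_iteration:
  fixes u :: "nat \<Rightarrow> complex \<Rightarrow> complex" and w :: "nat \<Rightarrow> real"
  assumes F: "finite F" and w: "\<And>k. w k > 0" and K: "K \<ge> 0"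
    and step: "\<And>a. \<exists>c. L2_set (\<lambda>k. cmod (c k) * w k) {..n} \<le> K * l2norm F a \<and>
      l2norm F (\<lambda>l. a l - (\<Sum>k\<le>n. c k * u k l)) \<le> l2norm F a / 2"
  shows "\<exists>c. L2_set (\<lambda>k. cmod (c k) * w k) {..n} \<le> 2 * K * l2norm F a \<and>
    (\<forall>l\<in>F. (\<Sum>k\<le>n. c k * u k l) = a l)"
proof -
  obtain sel where sel: "\<And>a. L2_set (\<lambda>k. cmod (sel a k) * w k) {..n} \<le> K * l2norm F a \<and>
      l2norm F (\<lambda>l. a l - (\<Sum>k\<le>n. sel a k * u k l)) \<le> l2norm F a / 2"
  proof -
    from step have "\<forall>a. \<exists>c. L2_set (\<lambda>k. cmod (c k) * w k) {..n} \<le> K * l2norm F a \<and>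
      l2norm F (\<lambda>l. a l - (\<Sum>k\<le>n. c k * u k l)) \<le> l2norm F a / 2" by (rule allI)
    from choice[OF this] show ?thesis
      by (elim exE, intro that) (erule spec)
  qed
  note sel1 = sel[THEN conjunct1] and sel2 = sel[THEN conjunct2]
  \<comment> \<open>\<open>A j\<close> is the residual after \<open>j\<close> corrections, so the
    partial sums of the corrections reproduce \<open>a - A J\<close> on \<open>F\<close>.\<close>
  define A where "A j = ((\<lambda>b l. b l - (\<Sum>k\<le>n. sel b k * u k l)) ^^ j) a" for j
  have A_Suc: "A (Suc j) = (\<lambda>l. A j l - (\<Sum>k\<le>n. sel (A j) k * u k l))" for j
    by (simp add: A_def)
  define d where "d j = sel (A j)" for j
  define t where "t = l2norm F a"
  have t: "t \<ge> 0" by (simp add: t_def)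
  have A_norm: "l2norm F (A j) \<le> (1/2) ^ j * t" for j
  proof (induction j)
    case 0
    then show ?case by (simp add: A_def t_def)
  next
    case (Suc j)
    have "l2norm F (A (Suc j)) \<le> l2norm F (A j) / 2"
      unfolding A_Suc by (rule sel2)
    with Suc show ?case by simp
  qed
  have d_norm: "L2_set (\<lambda>k. cmod (d j k) * w k) {..n} \<le> K * ((1/2) ^ j * t)" for j
    unfolding d_def using sel1[of "A j"] mult_left_mono[OF A_norm[of j] K] by linarith
  define S where "S J k = (\<Sum>j<J. d j k)" for J k
  have S_norm: "L2_set (\<lambda>k. cmod (S J k) * w k) {..n} \<le> 2 * K * t" for J
  proof -
    have "L2_set (\<lambda>k. cmod (S J k) * w k) {..n} \<le> (\<Sum>j<J. K * ((1/2) ^ j * t))"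
    proof (induction J)
      case 0
      then show ?case by (simp add: S_def L2_set_def)
    next
      case (Suc J)
      have "L2_set (\<lambda>k. cmod (S (Suc J) k) * w k) {..n}
          \<le> L2_set (\<lambda>k. cmod (S J k) * w k + cmod (d J k) * w k) {..n}"
      proof (rule L2_set_mono)
        fix k
        show "cmod (S (Suc J) k) * w k \<le> cmod (S J k) * w k + cmod (d J k) * w k"
          using mult_right_mono[OF norm_triangle_ineq[of "S J k" "d J k"] less_imp_le[OF w[of k]]]
          by (simp add: S_def distrib_right)
        show "0 \<le> cmod (S (Suc J) k) * w k"
          using w[of k] by simp
      qed
      also have "\<dots> \<le> L2_set (\<lambda>k. cmod (S J k) * w k) {..n} + L2_set (\<lambda>k. cmod (d J k) * w k) {..n}"
        by (rule L2_set_triangle_ineq)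
      finally show ?case using Suc d_norm[of J] by simp
    qed
    also have "\<dots> = K * t * (\<Sum>j<J. (1/2) ^ j)"
      by (simp add: sum_distrib_left mult_ac)
    also have "\<dots> \<le> K * t * 2"
      using K t by (intro mult_left_mono) (auto simp: geometric_sum)
    finally show ?thesis
      by (simp add: mult_ac)
  qed
  have "convergent (\<lambda>J. S J k)" if "k \<le> n" for k
  proof -
    have "summable (\<lambda>j. d j k)"
    proof (rule summable_comparison_test')
      show "summable (\<lambda>j. K * ((1/2) ^ j * t) / w k)"
        by (intro summable_divide summable_mult summable_mult2 summable_geometric) simp
      fix j :: nat
      have "cmod (d j k) * w k \<le> L2_set (\<lambda>k. cmod (d j k) * w k) {..n}"
        using that by (intro member_le_L2_set) auto
      also note d_norm
      finally show "norm (d j k) \<le> K * ((1/2) ^ j * t) / w k"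
        using w[of k] by (simp add: pos_le_divide_eq)
    qed
    then show ?thesis
      unfolding S_def by (simp add: summable_iff_convergent)
  qed
  then obtain c where c: "\<And>k. k \<le> n \<Longrightarrow> (\<lambda>J. S J k) \<longlonglongrightarrow> c k"
    unfolding convergent_def by metis
  show ?thesis
  proof (intro exI[of _ c] conjI ballI)
    have "(\<lambda>J. L2_set (\<lambda>k. cmod (S J k) * w k) {..n}) \<longlonglongrightarrow> L2_set (\<lambda>k. cmod (c k) * w k) {..n}"
      unfolding L2_set_def by (intro tendsto_intros c) auto
    then show "L2_set (\<lambda>k. cmod (c k) * w k) {..n} \<le> 2 * K * l2norm F a"
      by (rule LIMSEQ_le_const2) (use S_norm in \<open>auto simp: t_def\<close>)
  next
    fix l assume l: "l \<in> F"
    have partial: "(\<Sum>k\<le>n. S J k * u k l) = a l - A J l" for J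
    proof (induction J)
      case 0
      then show ?case by (simp add: S_def A_def)
    next
      case (Suc J)
      have "(\<Sum>k\<le>n. S (Suc J) k * u k l) = (\<Sum>k\<le>n. S J k * u k l) + (\<Sum>k\<le>n. d J k * u k l)"
        by (simp add: S_def distrib_right sum.distrib)
      then show ?case
        unfolding Suc A_Suc d_def by simp
    qed
    have "(\<lambda>J. A J l) \<longlonglongrightarrow> 0"
    proof (rule Lim_null_comparison)
      show "\<forall>\<^sub>F J in sequentially. norm (A J l) \<le> (1/2) ^ J * t"
      proof (intro always_eventually allI)
        fix J
        have "cmod (A J l) \<le> l2norm F (A J)"
          using F l by (intro member_le_L2_set)
        also note A_norm
        finally show "norm (A J l) \<le> (1/2) ^ J * t" .
      qed
      show "(\<lambda>J. (1/2) ^ J * t) \<longlonglongrightarrow> 0"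
        by (intro tendsto_mult_left_zero LIMSEQ_realpow_zero) auto
    qed
    then have "(\<lambda>J. a l - A J l) \<longlonglongrightarrow> a l - 0"
      by (intro tendsto_intros)
    moreover have "(\<lambda>J. \<Sum>k\<le>n. S J k * u k l) \<longlonglongrightarrow> (\<Sum>k\<le>n. c k * u k l)"
      by (intro tendsto_intros c) auto
    ultimately show "(\<Sum>k\<le>n. c k * u k l) = a l"
      unfolding partial by (simp add: LIMSEQ_unique)
  qed
qed

section \<open>The normalising factor of the polynomial kernel\<close>

lemma poly_kernel_diag:
  "poly_kernel n l l = of_real (\<Sum>k\<le>n. (pi * (cmod l)\<^sup>2) ^ k / fact k)"
proof -
  have "of_real pi * l * cnj l = complex_of_real (pi * (cmod l)\<^sup>2)"
    by (simp add: complex_norm_square[unfolded of_real_power] mult.assoc)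
  then show ?thesis
    unfolding poly_kernel_def by (simp only: of_real_sum of_real_divide of_real_power of_real_fact)
qed

text \<open>The real number \<open>k_n(l,l)^(-1/2)\<close>, the counterpart at degree
  \<open>n\<close> of the Gaussian factor \<open>exp (- pi * |l|^2 / 2)\<close>.\<close>

definition kernel_factor :: "nat \<Rightarrow> complex \<Rightarrow> real" where
  "kernel_factor n l = (\<Sum>k\<le>n. (pi * (cmod l)\<^sup>2) ^ k / fact k) powr (- (1 / 2))"

lemma diag_kernel_ge_1: "1 \<le> (\<Sum>k\<le>n. (pi * (cmod l)\<^sup>2) ^ k / fact k)"
proof -
  have "(\<Sum>k\<in>{0}. (pi * (cmod l)\<^sup>2) ^ k / fact k) \<le> (\<Sum>k\<le>n. (pi * (cmod l)\<^sup>2) ^ k / fact k)"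
    by (intro sum_mono2) auto
  then show ?thesis by simp
qed

lemma poly_kernel_powr: "poly_kernel n l l powr (- (1 / 2)) = of_real (kernel_factor n l)"
proof -
  have "poly_kernel n l l powr (of_real (- (1 / 2))) = of_real (kernel_factor n l)"
    unfolding poly_kernel_diag kernel_factor_def
    by (rule powr_of_real) (use diag_kernel_ge_1[where n=n and l=l] in linarith)+
  then show ?thesis by simp
qed

lemma kernel_factor_pos: "kernel_factor n l > 0"
  using diag_kernel_ge_1[where n=n and l=l] by (simp add: kernel_factor_def)

lemma kernel_factor_square:
  "(kernel_factor n l)\<^sup>2 = 1 / (exp (pi * (cmod l)\<^sup>2) - exp_tail (Suc n) (pi * (cmod l)\<^sup>2))"
proof -
  let ?s = "\<Sum>k\<le>n. (pi * (cmod l)\<^sup>2) ^ k / fact k"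
  have s: "?s > 0" using diag_kernel_ge_1[where n=n and l=l] by linarith
  have "(kernel_factor n l)\<^sup>2 = ?s powr (-1)"
    unfolding kernel_factor_def power2_eq_square powr_add[symmetric] by simp
  also have "\<dots> = 1 / ?s"
    using s by (simp add: powr_minus_divide)
  also have "?s = exp (pi * (cmod l)\<^sup>2) - exp_tail (Suc n) (pi * (cmod l)\<^sup>2)"
    by (simp add: exp_tail_def lessThan_Suc_atMost)
  finally show ?thesis .
qed

text \<open>The kernel is a partial sum of the exponential. Consequently, changing from the
  polynomial to the Fock normalisation does not enlarge the data.\<close>

lemma kernel_factor_ge: "exp (- pi * (cmod l)\<^sup>2 / 2) \<le> kernel_factor n l"
proof (rule power2_le_imp_le)
  have s: "exp (pi * (cmod l)\<^sup>2) - exp_tail (Suc n) (pi * (cmod l)\<^sup>2) > 0"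
    using diag_kernel_ge_1[where n=n and l=l] by (simp add: exp_tail_def lessThan_Suc_atMost)
  have "(exp (- pi * (cmod l)\<^sup>2 / 2))\<^sup>2 = 1 / exp (pi * (cmod l)\<^sup>2)"
    by (simp add: exp_double[symmetric] exp_minus field_simps)
  also have "\<dots> \<le> (kernel_factor n l)\<^sup>2"
    unfolding kernel_factor_square using s exp_tail_nonneg[of "pi * (cmod l)\<^sup>2" "Suc n"]
    by (intro divide_left_mono) auto
  finally show "(exp (- pi * (cmod l)\<^sup>2 / 2))\<^sup>2 \<le> (kernel_factor n l)\<^sup>2" .
qed (simp add: kernel_factor_pos less_imp_le)

text \<open>Cutting the Taylor series at degree \<open>n\<close> costs, at each node, a squared
  error of at most \<open>2 * q * (C * l2norm F a)^2\<close>. Summed over \<open>F\<close>, the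
  condition with constant 8 leaves a quarter of the squared norm of \<open>a\<close>.\<close>

lemma fock_truncation:
  assumes F: "finite F" and C: "C \<ge> 0" and interp: "\<And>a. interpolable F a (C * l2norm F a)"
    and q: "q \<ge> 0" "q \<le> 1 / 2" "8 * C\<^sup>2 * real (card F) * q \<le> 1"
    and tail: "\<And>l. l \<in> F \<Longrightarrow> exp_tail (Suc n) (pi * (cmod l)\<^sup>2) \<le> q * exp (pi * (cmod l)\<^sup>2)"
  shows "\<exists>c. L2_set (\<lambda>k. cmod (c k) * sqrt (fact k / pi ^ k)) {..n} \<le> C * l2norm F a \<and>
     l2norm F (\<lambda>l. a l - (\<Sum>k\<le>n. c k * (l ^ k * of_real (kernel_factor n l)))) \<le> l2norm F a / 2"
proof -
  \<comment> \<open>Rescaled so that a Fock function with weighted values \<open>b\<close> takes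
    exactly the values \<open>a\<close> when multiplied by \<open>kernel_factor n\<close>.\<close>
  define b where "b l = a l * of_real (exp (- pi * (cmod l)\<^sup>2 / 2) / kernel_factor n l)" for l
  have b_le: "l2norm F b \<le> l2norm F a"
  proof (rule L2_set_mono)
    fix l
    have "cmod (b l) = cmod (a l) * (exp (- pi * (cmod l)\<^sup>2 / 2) / kernel_factor n l)"
      using kernel_factor_pos[of n l] by (simp add: b_def norm_mult norm_divide)
    also have "\<dots> \<le> cmod (a l) * 1"
      using kernel_factor_ge[of l n] kernel_factor_pos[of n l] by (intro mult_left_mono) auto
    finally show "cmod (b l) \<le> cmod (a l)" by simp
  qed simp
  obtain f where f: "f \<in> fock_space" "fock_norm f \<le> C * l2norm F b"
    and fb: "\<And>l. l \<in> F \<Longrightarrow> f l * of_real (exp (- pi * (cmod l)\<^sup>2 / 2)) = b l"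
    using interp[of b] unfolding interpolable_def by blast
  have fC: "fock_norm f \<le> C * l2norm F a"
    using f(2) mult_left_mono[OF b_le C] by linarith
  obtain c where c: "\<And>z. (\<lambda>k. c k * z ^ k) sums f z"
    using f entire_power_series[of f] by (auto simp: fock_space_def)
  have fa: "f l * of_real (kernel_factor n l) = a l" if "l \<in> F" for l
  proof -
    have "(f l * of_real (kernel_factor n l)) * of_real (exp (- pi * (cmod l)\<^sup>2 / 2))
        = a l * of_real (exp (- pi * (cmod l)\<^sup>2 / 2))"
      using fb[OF that] kernel_factor_pos[of n l] by (simp add: b_def field_simps)
    then show ?thesis by simp
  qed
  show ?thesis
  proof (intro exI[of _ c] conjI)
    have "(L2_set (\<lambda>k. cmod (c k) * sqrt (fact k / pi ^ k)) {..n})\<^sup>2 = (\<Sum>k<Suc n. (cmod (c k))\<^sup>2 * (fact k / pi ^ k))"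
      unfolding L2_set_def lessThan_Suc_atMost by (simp add: power_mult_distrib sum_nonneg)
    also have "\<dots> \<le> (fock_norm f)\<^sup>2"
      by (rule fock_bessel[OF f(1) c])
    finally have "L2_set (\<lambda>k. cmod (c k) * sqrt (fact k / pi ^ k)) {..n} \<le> fock_norm f"
      by (rule power2_le_imp_le) (rule fock_norm_nonneg)
    with fC show "L2_set (\<lambda>k. cmod (c k) * sqrt (fact k / pi ^ k)) {..n} \<le> C * l2norm F a"
      by linarith
    let ?r = "\<lambda>l. a l - (\<Sum>k\<le>n. c k * (l ^ k * of_real (kernel_factor n l)))"
    have res: "(cmod (?r l))\<^sup>2 \<le> 2 * q * (C * l2norm F a)\<^sup>2" if l: "l \<in> F" for l
    proof -
      let ?x = "pi * (cmod l)\<^sup>2"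
      have "?r l = (f l - (\<Sum>k<Suc n. c k * l ^ k)) * of_real (kernel_factor n l)"
        unfolding fa[OF l, symmetric] lessThan_Suc_atMost
        by (simp add: left_diff_distrib sum_distrib_right mult.assoc)
      then have "(cmod (?r l))\<^sup>2 = (cmod (f l - (\<Sum>k<Suc n. c k * l ^ k)))\<^sup>2 * (kernel_factor n l)\<^sup>2"
        by (simp add: norm_mult power_mult_distrib)
      also have "\<dots> \<le> ((fock_norm f)\<^sup>2 * exp_tail (Suc n) ?x) * (kernel_factor n l)\<^sup>2"
        by (intro mult_right_mono fock_taylor_remainder f c) auto
      also have "\<dots> = (fock_norm f)\<^sup>2 * (exp_tail (Suc n) ?x * (kernel_factor n l)\<^sup>2)"
        by simp
      also have "\<dots> \<le> (C * l2norm F a)\<^sup>2 * (2 * q)"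
      proof (rule mult_mono)
        show "(fock_norm f)\<^sup>2 \<le> (C * l2norm F a)\<^sup>2"
          using fC by (intro power_mono fock_norm_nonneg)
        have t: "exp_tail (Suc n) ?x \<le> q * exp ?x"
          by (rule tail[OF l])
        also have qe: "q * exp ?x \<le> exp ?x / 2"
          using mult_right_mono[OF q(2), of "exp ?x"] by simp
        \<comment> \<open>Since \<open>q <= 1 / 2\<close>, the diagonal kernel retains at least half
          of the exponential; this is where the factor 2 in \<open>2 * q\<close> comes from.\<close>
        finally have d: "exp ?x / 2 \<le> exp ?x - exp_tail (Suc n) ?x"
          by simp
        have "exp_tail (Suc n) ?x / (exp ?x - exp_tail (Suc n) ?x) \<le> (q * exp ?x) / (exp ?x / 2)"
          using t d q(1) by (intro frac_le) auto
        then show "exp_tail (Suc n) ?x * (kernel_factor n l)\<^sup>2 \<le> 2 * q"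
          by (simp add: kernel_factor_square)
      qed (auto intro!: mult_nonneg_nonneg exp_tail_nonneg)
      finally show ?thesis by (simp add: mult.commute)
    qed
    have "(l2norm F ?r)\<^sup>2 = (\<Sum>l\<in>F. (cmod (?r l))\<^sup>2)"
      by (simp add: L2_set_def sum_nonneg)
    also have "\<dots> \<le> real (card F) * (2 * q * (C * l2norm F a)\<^sup>2)"
      using res by (intro sum_bounded_above)
    also have "\<dots> = (8 * C\<^sup>2 * real (card F) * q) * (l2norm F a / 2)\<^sup>2"
      by (simp add: power_mult_distrib power_divide)
    also have "\<dots> \<le> 1 * (l2norm F a / 2)\<^sup>2"
      using q(3) by (intro mult_right_mono) auto
    finally have "(l2norm F ?r)\<^sup>2 \<le> (l2norm F a / 2)\<^sup>2"
      unfolding mult_1 .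
    then show "l2norm F ?r \<le> l2norm F a / 2"
      by (rule power2_le_imp_le) simp
  qed
qed

lemma interpolating_polynomial:
  assumes F: "finite F" and C: "C \<ge> 0" and interp: "\<And>a. interpolable F a (C * l2norm F a)"
    and q: "q \<ge> 0" "q \<le> 1 / 2" "8 * C\<^sup>2 * real (card F) * q \<le> 1"
    and tail: "\<And>l. l \<in> F \<Longrightarrow> exp_tail (Suc n) (pi * (cmod l)\<^sup>2) \<le> q * exp (pi * (cmod l)\<^sup>2)"
  shows "\<exists>p\<in>poly_space n. (\<forall>l\<in>F. poly p l * poly_kernel n l l powr (- (1 / 2)) = a l) \<and>
    (fock_norm (poly p))\<^sup>2 \<le> (2 * C)\<^sup>2 * (\<Sum>l\<in>F. (cmod (a l))\<^sup>2)"
proof -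
  have "\<exists>c. L2_set (\<lambda>k. cmod (c k) * sqrt (fact k / pi ^ k)) {..n} \<le> 2 * C * l2norm F a \<and>
    (\<forall>l\<in>F. (\<Sum>k\<le>n. c k * (l ^ k * of_real (kernel_factor n l))) = a l)"
    by (rule finite_neumann_iteration[OF F _ C fock_truncation[OF F C interp q tail]]) auto
  then obtain c where c: "L2_set (\<lambda>k. cmod (c k) * sqrt (fact k / pi ^ k)) {..n} \<le> 2 * C * l2norm F a"
    and ca: "\<And>l. l \<in> F \<Longrightarrow> (\<Sum>k\<le>n. c k * (l ^ k * of_real (kernel_factor n l))) = a l"
    by blast
  define p where "p = (\<Sum>k\<le>n. monom (c k) k)"
  have p: "poly p = (\<lambda>z. \<Sum>k<Suc n. c k * z ^ k)"
    by (simp add: p_def poly_sum poly_monom fun_eq_iff lessThan_Suc_atMost)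
  show ?thesis
  proof (intro bexI[of _ p] conjI ballI)
    show "p \<in> poly_space n"
      unfolding poly_space_def p_def
      by (auto intro!: degree_sum_le order.trans[OF degree_monom_le])
    show "poly p l * poly_kernel n l l powr (- (1 / 2)) = a l" if "l \<in> F" for l
      unfolding poly_kernel_powr p lessThan_Suc_atMost using ca[OF that]
      by (simp add: sum_distrib_right mult.assoc)
    have "(fock_norm (poly p))\<^sup>2 = (L2_set (\<lambda>k. cmod (c k) * sqrt (fact k / pi ^ k)) {..n})\<^sup>2"
      unfolding p fock_norm_polynomial unfolding L2_set_def lessThan_Suc_atMost
      by (simp add: power_mult_distrib sum_nonneg)
    also have "\<dots> \<le> (2 * C * l2norm F a)\<^sup>2"
      using c by (intro power_mono) auto
    also have "\<dots> = (2 * C)\<^sup>2 * (\<Sum>l\<in>F. (cmod (a l))\<^sup>2)"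
      by (simp add: power_mult_distrib L2_set_def sum_nonneg)
    finally show "(fock_norm (poly p))\<^sup>2 \<le> (2 * C)\<^sup>2 * (\<Sum>l\<in>F. (cmod (a l))\<^sup>2)" .
  qed
qed

lemma pi_ge_1: "1 \<le> pi"
  using pi_gt3 by linarith

section \<open>Truncated sets form a uniform family\<close>

text \<open>The uniform constant is applied to two-point subsets with data 1 and 0, which have norm
  1.\<close>

lemma fock_interpolating_separated:
  assumes "fock_interpolating \<Lambda>"
  obtains \<delta> where "\<delta> > 0" "\<And>x y. x \<in> \<Lambda> \<Longrightarrow> y \<in> \<Lambda> \<Longrightarrow> x \<noteq> y \<Longrightarrow> \<delta> \<le> cmod (x - y)"
proof -
  obtain C where C: "C > 0" "\<And>F a. finite F \<Longrightarrow> F \<subseteq> \<Lambda> \<Longrightarrow> interpolable F a (C * l2norm F a)"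
    using fock_interpolating_uniform[OF assms] by blast
  show ?thesis
  proof
    show "1 / (C * exp (pi / 2) + 1) > 0"
      using C(1) by (intro divide_pos_pos add_pos_pos) auto
    fix x y assume xy: "x \<in> \<Lambda>" "y \<in> \<Lambda>" "x \<noteq> y"
    have "interpolable {x, y} (\<lambda>z. if z = x then 1 else 0) (C * l2norm {x, y} (\<lambda>z. if z = x then 1 else 0))"
      using xy by (intro C) auto
    also have "l2norm {x, y} (\<lambda>z. if z = x then 1 else 0) = 1"
      using xy by (simp add: L2_set_def)
    finally have "interpolable {x, y} (\<lambda>z. if z = x then 1 else 0) C"
      by simp
    then show "1 / (C * exp (pi / 2) + 1) \<le> cmod (x - y)"
      using xy by (intro interpolable_separation)
  qed
qed

text \<open>The term \<open>sqrt (2 * ln n)\<close> in the radius contributes a factor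
  \<open>1 / n\<close> to the tail, cancelling the number of nodes, which is at most
  \<open>B * n\<close>. The term \<open>\<tau>\<close> then makes the remaining constant as small as
  required.\<close>

lemma fock_interpolating_imp_uniform_family:
  assumes \<Lambda>: "fock_interpolating \<Lambda>"
  shows "\<exists>\<tau>0::real. \<tau>0 > 0 \<and> (\<forall>\<tau>\<ge>\<tau>0. \<forall>\<rho> :: nat \<Rightarrow> real.
    (\<forall>n. real n - sqrt (real n) * (sqrt (2 * ln (real n)) + \<tau>) > 0 \<longrightarrow>
       \<rho> n > 0 \<and> pi * (\<rho> n)\<^sup>2 = real n - sqrt (real n) * (sqrt (2 * ln (real n)) + \<tau>)) \<longrightarrow>
    uniform_interpolating_family (\<lambda>n. \<Lambda> \<inter> cball 0 (\<rho> n)))"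
proof -
  obtain C where C: "C > 0" "\<And>F a. finite F \<Longrightarrow> F \<subseteq> \<Lambda> \<Longrightarrow> interpolable F a (C * l2norm F a)"
    using fock_interpolating_uniform[OF \<Lambda>] by blast
  obtain \<delta> where \<delta>: "\<delta> > 0" and sep: "\<And>x y. x \<in> \<Lambda> \<Longrightarrow> y \<in> \<Lambda> \<Longrightarrow> x \<noteq> y \<Longrightarrow> \<delta> \<le> cmod (x - y)"
    using fock_interpolating_separated[OF \<Lambda>] by blast
  define B where "B = (4 / \<delta> + 2)\<^sup>2"
  have B: "B > 0"
  proof -
    have "4 / \<delta> + 2 > 0" using \<delta> by (intro add_pos_pos) auto
    then show ?thesis by (simp add: B_def)
  qed
  \<comment> \<open>A value of \<open>exp (- \<tau>^2 / 2)\<close> for which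
    \<open>q = y / n\<close> meets both smallness conditions of the truncation;
    \<open>\<tau>0\<close> below solves \<open>exp (- \<tau>0^2 / 2) = y\<close>.\<close>
  define y where "y = min (1 / 2) (1 / (8 * C\<^sup>2 * B))"
  have y: "0 < y" "y \<le> 1 / 2" "8 * C\<^sup>2 * B * y \<le> 1"
  proof -
    have p: "8 * C\<^sup>2 * B > 0" using C B by simp
    then show "0 < y" "y \<le> 1 / 2" by (auto simp: y_def)
    have "8 * C\<^sup>2 * B * y \<le> 8 * C\<^sup>2 * B * (1 / (8 * C\<^sup>2 * B))"
      using p by (intro mult_left_mono) (auto simp: y_def)
    also have "\<dots> = 1" using C(1) B by simp
    finally show "8 * C\<^sup>2 * B * y \<le> 1" .
  qed
  have lny: "ln y < 0"
    using y by simp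
  define \<tau>0 where "\<tau>0 = sqrt (- 2 * ln y)"
  have \<tau>0: "\<tau>0 > 0"
    using lny by (simp add: \<tau>0_def)
  \<comment> \<open>Finiteness is required for every index, and for small \<open>n\<close> the
    radius \<open>\<rho> n\<close> is unconstrained and may be negative.\<close>
  have fin: "finite (\<Lambda> \<inter> cball 0 R)" for R
  proof (cases "R \<ge> 0")
    case True
    then show ?thesis using separated_card(1)[OF \<delta> sep] by blast
  next
    case False
    then have "cball 0 R = ({} :: complex set)" by auto
    then show ?thesis by simp
  qed
  show ?thesis
  proof (intro exI[of _ \<tau>0] conjI \<tau>0 allI impI)
    fix \<tau> and \<rho> :: "nat \<Rightarrow> real"
    assume \<tau>: "\<tau>0 \<le> \<tau>" and \<rho>: "\<forall>n. real n - sqrt (real n) * (sqrt (2 * ln (real n)) + \<tau>) > 0 \<longrightarrow>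
       \<rho> n > 0 \<and> pi * (\<rho> n)\<^sup>2 = real n - sqrt (real n) * (sqrt (2 * ln (real n)) + \<tau>)"
    define g where "g = exp (- \<tau>\<^sup>2 / 2)"
    have g: "0 < g" "g \<le> y"
    proof -
      have "- 2 * ln y = \<tau>0\<^sup>2"
        using lny by (simp add: \<tau>0_def)
      also have "\<dots> \<le> \<tau>\<^sup>2"
        using \<tau> \<tau>0 by (intro power_mono) auto
      finally have "- \<tau>\<^sup>2 / 2 \<le> ln y" by simp
      then have "g \<le> exp (ln y)"
        unfolding g_def by (simp only: exp_le_cancel_iff)
      then show "g \<le> y" using y by simp
    qed (simp add: g_def)
    have "eventually (\<lambda>n. real n - sqrt (real n) * (sqrt (2 * ln (real n)) + \<tau>) > 0) sequentially"
      by real_asymp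
    then obtain n1 where n1: "\<And>n. n \<ge> n1 \<Longrightarrow> real n - sqrt (real n) * (sqrt (2 * ln (real n)) + \<tau>) > 0"
      by (auto simp: eventually_sequentially)
    show "uniform_interpolating_family (\<lambda>n. \<Lambda> \<inter> cball 0 (\<rho> n))"
      unfolding uniform_interpolating_family_def
    proof (intro conjI allI fin exI[of _ "(2 * C)\<^sup>2"] exI[of _ "max n1 1"] impI)
      show "(2 * C)\<^sup>2 > 0" using C by simp
      fix n a assume n: "n \<ge> max n1 1"
      then have n1': "n \<ge> 1" by simp
      define s where "s = sqrt (2 * ln (real n)) + \<tau>"
      have \<rho>n: "\<rho> n > 0" "pi * (\<rho> n)\<^sup>2 = real n - sqrt (real n) * s"
        using \<rho> n1[of n] n by (auto simp: s_def)
      have s: "s \<ge> 0" and ss: "2 * ln (real n) + \<tau>\<^sup>2 \<le> s\<^sup>2"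
      proof -
        have ln: "ln (real n) \<ge> 0" using n1' by simp
        have \<tau>': "\<tau> \<ge> 0" using \<tau> \<tau>0 by simp
        show "s \<ge> 0" using ln \<tau>' by (simp add: s_def)
        have "s\<^sup>2 = (sqrt (2 * ln (real n)))\<^sup>2 + \<tau>\<^sup>2 + 2 * sqrt (2 * ln (real n)) * \<tau>"
          by (simp add: s_def power2_sum)
        then show "2 * ln (real n) + \<tau>\<^sup>2 \<le> s\<^sup>2" using ln \<tau>' by simp
      qed
      have "(\<rho> n)\<^sup>2 \<le> real n"
      proof -
        have "1 * (\<rho> n)\<^sup>2 \<le> pi * (\<rho> n)\<^sup>2"
          by (intro mult_right_mono pi_ge_1) auto
        also have "\<dots> \<le> real n"
          unfolding \<rho>n(2) using s by simp
        finally show ?thesis by simp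
      qed
      then have \<rho>_le: "\<rho> n \<le> sqrt (real n)"
        by (rule real_le_rsqrt)
      let ?F = "\<Lambda> \<inter> cball 0 (\<rho> n)"
      have card: "real (card ?F) \<le> B * real n"
      proof -
        have "real (card ?F) \<le> (4 * \<rho> n / \<delta> + 2)\<^sup>2"
          using \<rho>n(1) by (intro separated_card(2)[OF \<delta> sep]) auto
        also have "\<dots> \<le> ((4 / \<delta> + 2) * sqrt (real n))\<^sup>2"
        proof (rule power_mono)
          have "4 * \<rho> n / \<delta> \<le> 4 / \<delta> * sqrt (real n)"
            using \<delta> \<rho>_le by (simp add: divide_right_mono)
          moreover have "2 \<le> 2 * sqrt (real n)" using n1' by simp
          ultimately show "4 * \<rho> n / \<delta> + 2 \<le> (4 / \<delta> + 2) * sqrt (real n)"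
            unfolding distrib_right by linarith
        qed (use \<delta> \<rho>n(1) in simp)
        also have "\<dots> = B * real n"
          by (simp add: B_def power_mult_distrib)
        finally show ?thesis .
      qed
      show "\<exists>p\<in>poly_space n. (\<forall>l\<in>?F. poly p l * poly_kernel n l l powr (- (1 / 2)) = a l) \<and>
          (fock_norm (poly p))\<^sup>2 \<le> (2 * C)\<^sup>2 * (\<Sum>l\<in>?F. (cmod (a l))\<^sup>2)"
      proof (rule interpolating_polynomial[where q = "g / real n", OF fin])
        show "C \<ge> 0" using C by simp
        show "interpolable ?F a (C * l2norm ?F a)" for a
          by (intro C fin) auto
        show "g / real n \<ge> 0" using g by simp
        have "g / real n \<le> g / 1"
          using g n1' by (intro divide_left_mono) auto
        then show "g / real n \<le> 1 / 2" using g(2) y(2) by linarith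
        have "8 * C\<^sup>2 * real (card ?F) * (g / real n) \<le> 8 * C\<^sup>2 * (B * real n) * (y / real n)"
          using card g by (intro mult_mono divide_right_mono) (auto simp: B less_imp_le y)
        also have "\<dots> = 8 * C\<^sup>2 * B * y"
          using n1' by simp
        finally show "8 * C\<^sup>2 * real (card ?F) * (g / real n) \<le> 1"
          using y by simp
        fix l assume "l \<in> ?F"
        then have "cmod l \<le> \<rho> n" by simp
        then have "pi * (cmod l)\<^sup>2 \<le> real n - sqrt (real n) * s"
          unfolding \<rho>n(2)[symmetric] by (intro mult_left_mono power_mono) auto
        then have "exp_tail (Suc n) (pi * (cmod l)\<^sup>2) \<le> exp (pi * (cmod l)\<^sup>2) * exp (- s\<^sup>2 / 2)"
          using n1' s by (intro exp_tail_gaussian_bound) auto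
        also have "\<dots> \<le> exp (pi * (cmod l)\<^sup>2) * (g / real n)"
        proof (rule mult_left_mono)
          have "exp (- s\<^sup>2 / 2) \<le> exp (- \<tau>\<^sup>2 / 2 - ln (real n))"
            using ss by simp
          also have "\<dots> = g / real n"
            using n1' by (simp add: g_def exp_diff)
          finally show "exp (- s\<^sup>2 / 2) \<le> g / real n" .
        qed simp
        finally show "exp_tail (Suc n) (pi * (cmod l)\<^sup>2) \<le> g / real n * exp (pi * (cmod l)\<^sup>2)"
          by (simp add: mult.commute)
      qed
    qed
  qed
qed

section \<open>Weak limits\<close>

text \<open>The test disc is the unit disc centred at \<open>l\<close> itself: its boundary circle,
  which belongs to both compared sets, is then too far away to be the nearby point.\<close>

lemma weak_limit_approx:
  assumes wl: "weak_limit L \<Lambda>" and l: "l \<in> \<Lambda>" and e: "e > 0"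
  shows "\<forall>\<^sub>F n in sequentially. \<exists>x\<in>L n. dist l x < e"
proof -
  let ?S = "frontier (cball l 1)"
  let ?X = "\<lambda>n. (L n \<inter> cball l 1) \<union> ?S"
  let ?Y = "(\<Lambda> \<inter> cball l 1) \<union> ?S"
  have S: "?S = sphere l 1"
    by (rule frontier_cball)
  have x0: "l + 1 \<in> ?S"
    unfolding S by (simp add: dist_norm)
  have le: "infdist l (?X n) \<le> hausdorff_dist (?X n) ?Y" for n
  proof -
    \<comment> \<open>A supremum of reals dominates its members only when the set is bounded; a
      fixed point of the circle bounds all the distances.\<close>
    have "bdd_above ((\<lambda>y. infdist y (?X n)) ` ?Y)"
    proof (rule bdd_aboveI2)
      fix y assume "y \<in> ?Y"
      then have y: "dist l y \<le> 1" by (auto simp: S)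
      have "infdist y (?X n) \<le> dist y (l + 1)"
        using x0 by (intro infdist_le) auto
      also have "\<dots> \<le> dist y l + dist l (l + 1)"
        by (rule dist_triangle)
      also have "\<dots> \<le> 2"
        using y by (simp add: dist_commute dist_norm)
      finally show "infdist y (?X n) \<le> 2" .
    qed
    then have "infdist l (?X n) \<le> (SUP y\<in>?Y. infdist y (?X n))"
      using l by (intro cSUP_upper) auto
    then show ?thesis
      by (simp add: hausdorff_dist_def)
  qed
  have "(\<lambda>n. hausdorff_dist (?X n) ?Y) \<longlonglongrightarrow> 0"
    using wl unfolding weak_limit_def by simp
  moreover have "min e 1 > 0" using e by simp
  ultimately have "\<forall>\<^sub>F n in sequentially. hausdorff_dist (?X n) ?Y < min e 1"
    by (rule order_tendstoD(2))
  then show ?thesis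
  proof eventually_elim
    case (elim n)
    then have "infdist l (?X n) < min e 1"
      using le[of n] by linarith
    moreover have ne: "?X n \<noteq> {}" using x0 by auto
    ultimately have "(INF x\<in>?X n. dist l x) < min e 1"
      by (simp add: infdist_notempty)
    then obtain x where x: "x \<in> ?X n" "dist l x < min e 1"
      using ne by (subst (asm) cINF_less_iff) (auto intro: bdd_belowI2[of _ 0])
    then show ?case by (auto simp: S)
  qed
qed

text \<open>A nearest point of the finite set \<open>L n\<close> serves all tolerances at once. If
  \<open>L n\<close> is empty the chosen value is arbitrary, which happens only for finitely many
  \<open>n\<close>.\<close>

lemma weak_limit_sequence:
  assumes wl: "weak_limit L \<Lambda>" and l: "l \<in> \<Lambda>" and fin: "\<And>n. finite (L n)"
  obtains g where "g \<longlonglongrightarrow> l" "\<forall>\<^sub>F n in sequentially. g n \<in> L n"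
proof
  let ?g = "\<lambda>n. arg_min_on (dist l) (L n)"
  have g: "?g n \<in> L n \<and> dist l (?g n) \<le> dist l x" if "x \<in> L n" for n x
    using arg_min_if_finite[OF fin[of n], of "dist l"] that by (auto simp: not_less)
  show "?g \<longlonglongrightarrow> l"
  proof (rule tendstoI)
    fix e :: real assume "e > 0"
    show "\<forall>\<^sub>F n in sequentially. dist (?g n) l < e"
      using weak_limit_approx[OF wl l \<open>e > 0\<close>]
    proof eventually_elim
      case (elim n)
      then obtain x where "x \<in> L n" "dist l x < e" by blast
      with g[OF \<open>x \<in> L n\<close>] show ?case
        by (simp add: dist_commute)
    qed
  qed
  show "\<forall>\<^sub>F n in sequentially. ?g n \<in> L n"
    using weak_limit_approx[OF wl l zero_less_one] by eventually_elim (use g in blast)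
qed

text \<open>With parameter 2, Chernoff's bound gives a tail of at most
  \<open>exp (2 * x) / 2 ^ Suc n\<close>, which tends to 0 along convergent nodes.\<close>

lemma kernel_factor_tendsto:
  assumes z: "z \<longlonglongrightarrow> l"
  shows "(\<lambda>n. kernel_factor n (z n)) \<longlonglongrightarrow> exp (- pi * (cmod l)\<^sup>2 / 2)"
proof -
  let ?x = "\<lambda>n. pi * (cmod (z n))\<^sup>2"
  have x: "?x \<longlonglongrightarrow> pi * (cmod l)\<^sup>2"
    by (intro tendsto_intros z)
  have "(\<lambda>n. exp_tail (Suc n) (?x n)) \<longlonglongrightarrow> 0"
  proof (rule tendsto_sandwich)
    show "\<forall>\<^sub>F n in sequentially. 0 \<le> exp_tail (Suc n) (?x n)"
      by (intro always_eventually allI exp_tail_nonneg) simp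
    show "\<forall>\<^sub>F n in sequentially. exp_tail (Suc n) (?x n) \<le> exp (2 * ?x n) * (1 / 2) ^ Suc n"
      using exp_tail_Chernoff[of "?x _" 2 "Suc _"]
      by (intro always_eventually allI) (simp add: power_one_over field_simps)
    have "(\<lambda>n. (1 / 2 :: real) ^ Suc n) \<longlonglongrightarrow> 0"
      by (intro LIMSEQ_Suc LIMSEQ_realpow_zero) auto
    then have "(\<lambda>n. exp (2 * ?x n) * (1 / 2) ^ Suc n) \<longlonglongrightarrow> exp (2 * (pi * (cmod l)\<^sup>2)) * 0"
      by (intro tendsto_intros x)
    then show "(\<lambda>n. exp (2 * ?x n) * (1 / 2) ^ Suc n) \<longlonglongrightarrow> 0" by simp
  qed simp
  then have "(\<lambda>n. exp (?x n) - exp_tail (Suc n) (?x n)) \<longlonglongrightarrow> exp (pi * (cmod l)\<^sup>2) - 0"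
    by (intro tendsto_intros x)
  then have "(\<lambda>n. \<Sum>k\<le>n. ?x n ^ k / fact k) \<longlonglongrightarrow> exp (pi * (cmod l)\<^sup>2)"
    by (simp add: exp_tail_def lessThan_Suc_atMost)
  then have "(\<lambda>n. (\<Sum>k\<le>n. ?x n ^ k / fact k) powr (- (1 / 2))) \<longlonglongrightarrow> exp (pi * (cmod l)\<^sup>2) powr (- (1 / 2))"
    by (intro tendsto_intros) auto
  then show ?thesis
    by (simp add: kernel_factor_def powr_def)
qed

text \<open>The data on \<open>F\<close> are moved to nearby nodes of \<open>L n\<close> and
  interpolated by polynomials of norm at most \<open>sqrt A * l2norm F a\<close>. A normal family
  limit has the right values at the original points because nodes and normalising factors
  converge.\<close>

lemma weak_limit_finite_interpolable:
  assumes L: "\<And>n. finite (L n)"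
    and A: "A > 0" "\<And>n a. n \<ge> n0 \<Longrightarrow> \<exists>p\<in>poly_space n.
        (\<forall>l\<in>L n. poly p l * poly_kernel n l l powr (- (1 / 2)) = a l) \<and>
        (fock_norm (poly p))\<^sup>2 \<le> A * (\<Sum>l\<in>L n. (cmod (a l))\<^sup>2)"
    and wl: "weak_limit L \<Lambda>" and F: "finite F" "F \<subseteq> \<Lambda>"
  shows "interpolable F a (sqrt A * l2norm F a)"
proof -
  have "\<exists>g. g \<longlonglongrightarrow> l \<and> (\<forall>\<^sub>F n in sequentially. g n \<in> L n)" if "l \<in> F" for l
    using weak_limit_sequence[OF wl _ L, of l] F that by blast
  then obtain g where g_lim: "\<And>l. l \<in> F \<Longrightarrow> g l \<longlonglongrightarrow> l"
    and g_in: "\<And>l. l \<in> F \<Longrightarrow> \<forall>\<^sub>F n in sequentially. g l n \<in> L n"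
    by metis
  have ev1: "\<forall>\<^sub>F n in sequentially. \<forall>l\<in>F. g l n \<in> L n"
    using g_in F(1) by (simp add: eventually_ball_finite_distrib)
  \<comment> \<open>Distinct points must have distinct approximants, or the transferred data would
    be ill-defined.\<close>
  have "\<forall>\<^sub>F n in sequentially. g l n \<noteq> g l' n" if "l \<in> F" "l' \<in> F" "l \<noteq> l'" for l l'
  proof -
    have "(\<lambda>n. g l n - g l' n) \<longlonglongrightarrow> l - l'"
      by (intro tendsto_intros g_lim that)
    then have "\<forall>\<^sub>F n in sequentially. g l n - g l' n \<noteq> 0"
      by (rule tendsto_imp_eventually_ne) (use that in simp)
    then show ?thesis by eventually_elim simp
  qed
  then have "\<forall>\<^sub>F n in sequentially. \<forall>l\<in>F. \<forall>l'\<in>F. l \<noteq> l' \<longrightarrow> g l n \<noteq> g l' n"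
    using F(1) by (simp add: eventually_ball_finite_distrib)
  with ev1 have "\<forall>\<^sub>F n in sequentially. (\<forall>l\<in>F. g l n \<in> L n) \<and> inj_on (\<lambda>l. g l n) F"
    by eventually_elim (auto simp: inj_on_def)
  then obtain N1 where N1: "\<And>n. n \<ge> N1 \<Longrightarrow> (\<forall>l\<in>F. g l n \<in> L n) \<and> inj_on (\<lambda>l. g l n) F"
    by (auto simp: eventually_sequentially)
  define N where "N = max n0 N1"
  have "\<exists>p. (\<forall>l\<in>F. poly p (g l n) * of_real (kernel_factor n (g l n)) = a l) \<and>
      fock_norm (poly p) \<le> sqrt A * l2norm F a" if n: "n \<ge> N" for n
  proof -
    let ?g = "\<lambda>l. g l n"
    have gL: "?g ` F \<subseteq> L n" and inj: "inj_on ?g F"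
      using N1[of n] n by (auto simp: N_def)
    \<comment> \<open>Zero on the remaining nodes of \<open>L n\<close>, so the norm of the data
      does not grow with \<open>n\<close>.\<close>
    define b where "b x = (if x \<in> ?g ` F then a (the_inv_into F ?g x) else 0)" for x
    have bg: "b (?g l) = a l" if "l \<in> F" for l
      using that by (simp add: b_def the_inv_into_f_f[OF inj])
    have "n \<ge> n0" using n by (simp add: N_def)
    from A(2)[OF this, of b] obtain p where
      p: "\<And>l. l \<in> L n \<Longrightarrow> poly p l * poly_kernel n l l powr (- (1 / 2)) = b l"
        "(fock_norm (poly p))\<^sup>2 \<le> A * (\<Sum>l\<in>L n. (cmod (b l))\<^sup>2)"
      by blast
    have "(\<Sum>l\<in>L n. (cmod (b l))\<^sup>2) = (\<Sum>l\<in>?g ` F. (cmod (b l))\<^sup>2)"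
      using L gL by (intro sum.mono_neutral_right) (auto simp: b_def)
    also have "\<dots> = (\<Sum>l\<in>F. (cmod (a l))\<^sup>2)"
      using bg by (simp add: sum.reindex[OF inj])
    also have "\<dots> = (l2norm F a)\<^sup>2"
      by (simp add: L2_set_def sum_nonneg)
    finally have "(fock_norm (poly p))\<^sup>2 \<le> (sqrt A * l2norm F a)\<^sup>2"
      using p(2) A(1) by (simp add: power_mult_distrib)
    then have "fock_norm (poly p) \<le> sqrt A * l2norm F a"
      by (rule power2_le_imp_le) (use A(1) in simp)
    moreover have "poly p (g l n) * of_real (kernel_factor n (g l n)) = a l" if "l \<in> F" for l
      using p(1)[of "g l n"] gL that bg[OF that] unfolding poly_kernel_powr by auto
    ultimately show ?thesis by blast
  qed
  then obtain p where p: "\<And>n l. n \<ge> N \<Longrightarrow> l \<in> F \<Longrightarrow> poly (p n) (g l n) * of_real (kernel_factor n (g l n)) = a l"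
    and p_norm: "\<And>n. n \<ge> N \<Longrightarrow> fock_norm (poly (p n)) \<le> sqrt A * l2norm F a"
    by metis
  have poly_fock: "poly p \<in> fock_space" for p
  proof -
    have "poly p = (\<lambda>z. \<Sum>k<Suc (degree p). coeff p k * z ^ k)"
      unfolding lessThan_Suc_atMost by (rule ext, rule poly_altdef)
    then show ?thesis
      by (simp only: polynomial_in_fock_space)
  qed
  obtain f r where f: "f \<in> fock_space" "fock_norm f \<le> sqrt A * l2norm F a" and r: "strict_mono (r :: nat \<Rightarrow> nat)"
    and lim: "\<And>\<zeta> z. \<zeta> \<longlonglongrightarrow> z \<Longrightarrow> (\<lambda>j. poly (p (N + r j)) (\<zeta> j)) \<longlonglongrightarrow> f z"
    by (rule fock_normal_family[of "\<lambda>j. poly (p (N + j))" "sqrt A * l2norm F a"]) (use poly_fock p_norm in auto)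
  have sub: "strict_mono (\<lambda>j. N + r j)"
    using r by (simp add: strict_mono_def)
  have "f l * of_real (exp (- pi * (cmod l)\<^sup>2 / 2)) = a l" if l: "l \<in> F" for l
  proof -
    have "(\<lambda>j. g l (N + r j)) \<longlonglongrightarrow> l"
      using LIMSEQ_subseq_LIMSEQ[OF g_lim[OF l] sub] by (simp add: o_def)
    then have 1: "(\<lambda>j. poly (p (N + r j)) (g l (N + r j))) \<longlonglongrightarrow> f l"
      by (rule lim)
    have "(\<lambda>j. kernel_factor (N + r j) (g l (N + r j))) \<longlonglongrightarrow> exp (- pi * (cmod l)\<^sup>2 / 2)"
      using LIMSEQ_subseq_LIMSEQ[OF kernel_factor_tendsto[OF g_lim[OF l]] sub] by (simp add: o_def)
    with 1 have "(\<lambda>j. poly (p (N + r j)) (g l (N + r j)) * of_real (kernel_factor (N + r j) (g l (N + r j))))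
        \<longlonglongrightarrow> f l * of_real (exp (- pi * (cmod l)\<^sup>2 / 2))"
      by (intro tendsto_intros)
    then have "(\<lambda>j. a l) \<longlonglongrightarrow> f l * of_real (exp (- pi * (cmod l)\<^sup>2 / 2))"
      by (simp add: p l)
    then show ?thesis
      by (simp add: LIMSEQ_const_iff)
  qed
  then show ?thesis
    using f unfolding interpolable_def by blast
qed

section \<open>From finite subsets to the whole set\<close>

text \<open>Along a convergent subsequence of solutions, each single condition holds from some index
  on and therefore survives in the limit.\<close>

lemma interpolable_increasing_union:
  fixes x :: "nat \<Rightarrow> complex"
  assumes "\<And>j. interpolable (x ` {..<j}) a K"
  shows "interpolable (range x) a K"
proof -
  have "\<exists>f. f \<in> fock_space \<and> fock_norm f \<le> K \<and>
      (\<forall>i<j. f (x i) * of_real (exp (- pi * (cmod (x i))\<^sup>2 / 2)) = a (x i))" for j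
    using assms[of j] unfolding interpolable_def by blast
  then obtain F where F: "\<And>j. F j \<in> fock_space" "\<And>j. fock_norm (F j) \<le> K"
    "\<And>i j. i < j \<Longrightarrow> F j (x i) * of_real (exp (- pi * (cmod (x i))\<^sup>2 / 2)) = a (x i)"
    by metis
  obtain f r where f: "f \<in> fock_space" "fock_norm f \<le> K" and r: "strict_mono (r :: nat \<Rightarrow> nat)"
    and lim: "\<And>\<zeta> z. \<zeta> \<longlonglongrightarrow> z \<Longrightarrow> (\<lambda>j. F (r j) (\<zeta> j)) \<longlonglongrightarrow> f z"
    by (rule fock_normal_family[of F K, OF F(1,2)], rule that)
  have "f (x i) * of_real (exp (- pi * (cmod (x i))\<^sup>2 / 2)) = a (x i)" for i
  proof (rule LIMSEQ_unique)
    show "(\<lambda>j. F (r j) (x i) * of_real (exp (- pi * (cmod (x i))\<^sup>2 / 2)))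
        \<longlonglongrightarrow> f (x i) * of_real (exp (- pi * (cmod (x i))\<^sup>2 / 2))"
      by (intro tendsto_intros lim)
    have "i < r j" if "j \<ge> Suc i" for j
      using seq_suble[OF r, of j] that by linarith
    then show "(\<lambda>j. F (r j) (x i) * of_real (exp (- pi * (cmod (x i))\<^sup>2 / 2))) \<longlonglongrightarrow> a (x i)"
      using F(3) by (intro tendsto_eventually eventually_sequentiallyI[of "Suc i"]) blast
  qed
  then show ?thesis
    using f unfolding interpolable_def by blast
qed

text \<open>Each point is isolated by a member of a countable basis, and distinct points get
  distinct members.\<close>

lemma countable_if_not_islimpt:
  fixes S :: "'a::second_countable_topology set"
  assumes "\<And>x. x \<in> S \<Longrightarrow> \<not> x islimpt S"
  shows "countable S"
proof -
  obtain B :: "'a set set" where B: "countable B" "topological_basis B"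
    using ex_countable_basis by blast
  have "\<exists>U\<in>B. U \<inter> S = {x}" if "x \<in> S" for x
  proof -
    obtain T where T: "x \<in> T" "open T" "\<forall>y\<in>S. y \<in> T \<longrightarrow> y = x"
      using assms[OF \<open>x \<in> S\<close>] unfolding islimpt_def by blast
    obtain U where "U \<in> B" "x \<in> U" "U \<subseteq> T"
      using topological_basisE[OF B(2) T(2,1)] by metis
    then show ?thesis using T that by blast
  qed
  then obtain U where U: "\<And>x. x \<in> S \<Longrightarrow> U x \<in> B" "\<And>x. x \<in> S \<Longrightarrow> U x \<inter> S = {x}"
    by metis
  have "inj_on U S"
    by (rule inj_onI) (metis U(2) singleton_inject)
  moreover have "countable (U ` S)"
    using U(1) by (intro countable_subset[OF _ B(1)]) auto
  ultimately show ?thesis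
    by (rule countable_image_inj_on[rotated])
qed

text \<open>A function of bounded norm cannot be 1 at \<open>l\<close> and vanish at points accumulating at \<open>l\<close>.\<close>

lemma finitely_interpolable_not_islimpt:
  assumes fin: "\<And>F a. finite F \<Longrightarrow> F \<subseteq> \<Lambda> \<Longrightarrow> interpolable F a (K * l2norm F a)" and l: "l \<in> \<Lambda>"
  shows "\<not> l islimpt \<Lambda>"
proof
  assume "l islimpt \<Lambda>"
  then obtain x where x: "\<And>n. x n \<in> \<Lambda> - {l}" and lim: "x \<longlonglongrightarrow> l"
    unfolding islimpt_sequential by blast
  \<comment> \<open>The point \<open>l\<close> is listed first, followed by the points that
    accumulate at it.\<close>
  define y where "y = case_nat l x"
  let ?a = "\<lambda>z. if z = l then 1 else 0"
  have y: "range y \<subseteq> \<Lambda>"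
    using l x by (auto simp: y_def split: nat.splits)
  have "interpolable (y ` {..<j}) ?a \<bar>K\<bar>" for j
  \<comment> \<open>Inserting \<open>l\<close> makes the norm of the data exactly 1 for every
    \<open>j\<close>, including the empty prefix at \<open>j = 0\<close>.\<close>
  proof (rule interpolable_mono[OF fin[of "insert l (y ` {..<j})" ?a]])
    have "l2norm (insert l (y ` {..<j})) ?a = sqrt (\<Sum>z\<in>{l}. 1)"
      unfolding L2_set_def by (intro arg_cong[where f = sqrt] sum.mono_neutral_cong_right) auto
    then show "K * l2norm (insert l (y ` {..<j})) ?a \<le> \<bar>K\<bar>" by simp
  qed (use y l in auto)
  then have "interpolable (range y) ?a \<bar>K\<bar>"
    by (rule interpolable_increasing_union)
  then obtain f where f: "f \<in> fock_space"
    and fy: "\<And>n. f (y n) * of_real (exp (- pi * (cmod (y n))\<^sup>2 / 2)) = ?a (y n)"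
    unfolding interpolable_def by blast
  have "f (x n) = 0" for n
    using fy[of "Suc n"] x[of n] by (simp add: y_def)
  moreover have "(\<lambda>n. f (x n)) \<longlonglongrightarrow> f l"
    using continuous_on_tendsto_compose[OF fock_space_continuous[OF f] lim] by simp
  ultimately have "f l = 0"
    by (simp add: LIMSEQ_const_iff)
  with fy[of 0] show False
    by (simp add: y_def)
qed

text \<open>The absence of accumulation points makes the set countable, so it can be enumerated. The
  norms of the data on finite prefixes are at most the root of the infinite sum, which gives the
  common bound needed for the limit.\<close>

lemma fock_interpolating_if_finitely_interpolable:
  assumes K: "K \<ge> 0" and fin: "\<And>F a. finite F \<Longrightarrow> F \<subseteq> \<Lambda> \<Longrightarrow> interpolable F a (K * l2norm F a)"
  shows "fock_interpolating \<Lambda>"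
proof (cases "\<Lambda> = {}")
  case True
  then show ?thesis
    unfolding fock_interpolating_def using fock_space_0 by blast
next
  case False
  have "countable \<Lambda>"
    using finitely_interpolable_not_islimpt[OF fin] by (intro countable_if_not_islimpt)
  with False have range: "range (from_nat_into \<Lambda>) = \<Lambda>"
    by (rule range_from_nat_into)
  show ?thesis
    unfolding fock_interpolating_def
  proof (intro allI impI)
    fix a :: "complex \<Rightarrow> complex"
    assume sm: "(\<lambda>l. (cmod (a l))\<^sup>2) summable_on \<Lambda>"
    let ?s = "infsum (\<lambda>l. (cmod (a l))\<^sup>2) \<Lambda>"
    have "interpolable (from_nat_into \<Lambda> ` {..<j}) a (K * sqrt ?s)" for j
    proof (rule interpolable_mono[OF fin])
      have sub: "from_nat_into \<Lambda> ` {..<j} \<subseteq> \<Lambda>"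
        using range by blast
      then show "from_nat_into \<Lambda> ` {..<j} \<subseteq> \<Lambda>" .
      have "(\<Sum>l\<in>from_nat_into \<Lambda> ` {..<j}. (cmod (a l))\<^sup>2) \<le> ?s"
        by (rule finite_sum_le_infsum[OF sm]) (use sub in auto)
      then show "K * l2norm (from_nat_into \<Lambda> ` {..<j}) a \<le> K * sqrt ?s"
        unfolding L2_set_def using K by (intro mult_left_mono real_sqrt_le_mono) auto
    qed auto
    then have "interpolable \<Lambda> a (K * sqrt ?s)"
      using interpolable_increasing_union[of "from_nat_into \<Lambda>"] range by simp
    then show "\<exists>f\<in>fock_space. \<forall>l\<in>\<Lambda>. f l * of_real (exp (- pi * (cmod l)\<^sup>2 / 2)) = a l"
      unfolding interpolable_def by blast
  qed
qed

theorem theorem1p2: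
  shows "(\<forall>\<Lambda> :: complex set. fock_interpolating \<Lambda> \<longrightarrow>
           (\<exists>\<tau>0::real. \<tau>0 > 0 \<and> (\<forall>\<tau>\<ge>\<tau>0. \<forall>\<rho> :: nat \<Rightarrow> real.
              (\<forall>n. real n - sqrt (real n) * (sqrt (2 * ln (real n)) + \<tau>) > 0 \<longrightarrow>
                   \<rho> n > 0 \<and>
                   pi * (\<rho> n)\<^sup>2 = real n - sqrt (real n) * (sqrt (2 * ln (real n)) + \<tau>)) \<longrightarrow>
              uniform_interpolating_family (\<lambda>n. \<Lambda> \<inter> cball 0 (\<rho> n)))))
       \<and> (\<forall>L :: nat \<Rightarrow> complex set. uniform_interpolating_family L \<longrightarrow>
           (\<forall>\<Lambda>. weak_limit L \<Lambda> \<longrightarrow> fock_interpolating \<Lambda>))"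
proof (intro conjI allI impI)
  fix \<Lambda> :: "complex set"
  assume "fock_interpolating \<Lambda>"
  then show "\<exists>\<tau>0::real. \<tau>0 > 0 \<and> (\<forall>\<tau>\<ge>\<tau>0. \<forall>\<rho> :: nat \<Rightarrow> real.
              (\<forall>n. real n - sqrt (real n) * (sqrt (2 * ln (real n)) + \<tau>) > 0 \<longrightarrow>
                   \<rho> n > 0 \<and>
                   pi * (\<rho> n)\<^sup>2 = real n - sqrt (real n) * (sqrt (2 * ln (real n)) + \<tau>)) \<longrightarrow>
              uniform_interpolating_family (\<lambda>n. \<Lambda> \<inter> cball 0 (\<rho> n)))"
    by (rule fock_interpolating_imp_uniform_family)
next
  fix L :: "nat \<Rightarrow> complex set" and \<Lambda>
  assume L: "uniform_interpolating_family L" and wl: "weak_limit L \<Lambda>"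
  from L obtain A n0 where "\<And>n. finite (L n)" "A > 0" "\<And>n a. n \<ge> n0 \<Longrightarrow> \<exists>p\<in>poly_space n.
        (\<forall>l\<in>L n. poly p l * poly_kernel n l l powr (- (1 / 2)) = a l) \<and>
        (fock_norm (poly p))\<^sup>2 \<le> A * (\<Sum>l\<in>L n. (cmod (a l))\<^sup>2)"
    unfolding uniform_interpolating_family_def by blast
  note fin = weak_limit_finite_interpolable[OF this wl]
  show "fock_interpolating \<Lambda>"
    by (rule fock_interpolating_if_finitely_interpolable[OF _ fin]) (use \<open>A > 0\<close> in auto)
qed

end
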